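(* Let $G$ be a second-countable locally compact non-compact group, $S\subset G$, $1\le p<+\infty$, let $\Gamma\subset\mathbb{C}$ be such that $\Gamma\setminus\{0\}$ is non-empty, and let $\omega$ be a locally $p$-integrable $S$-admissible weight on $G$. If $\Gamma\setminus\{0\}$ is bounded and bounded away from zero, then $L^p(G,\omega)$ has an $S$-dense vector if and only if it has a $(\Gamma,S)$-dense vector.
   Context: Let $\mu$ be a left Haar measure on $G$. A weight on $G$ is a positive measurable function $\omega:G\to(0,+\infty)$; it is locally $p$-integrable if $\int_K\omega^p\,d\mu<+\infty$ for every compact $K\subset G$. $L^p(G,\omega)$ is the space of measurable $f:G\to\mathbb{C}$ (modulo a.e. equality) with $\|f\|_{p,\omega}:=\left(\int_G|f(t)|^p\omega(t)^p\,d\mu(t)\right)^{1/p}<\infty$, with this norm. For $s\in G$, the left translation is $(T_sf)(t)=f(s^{-1}t)$. The weight $\omega$ is $S$-admissible if $M(s):=\operatorname{ess\,sup}_{t\in G}\omega(st)/\omega(t)<+\infty$ for all $s\in S$ (equivalently, $T_s$ is a bounded operator of $L^p(G,\omega)$ into itself for every $s\in S$). A vector $f\in L^p(G,\omega)$ is $S$-dense if $\{T_sf:\ s\in S\}$ is dense in $L^p(G,\omega)$, and $(\Gamma,S)$-dense if $\{\lambda T_sf:\ \lambda\in\Gamma,\ s\in S\}$ is dense in $L^p(G,\omega)$. *)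

theory Defs
  imports "HOL-Analysis.Analysis" "HOL-Probability.Essential_Supremum"
begin

text \<open>
  The group \<open>G\<close> is the whole type \<open>'a\<close>.  Topological groups are those of the class
  \<open>topological_group_add\<close>: the group law is written \<open>+\<close> but is not assumed commutative, so
  \<open>s + t\<close>, \<open>- s\<close> and \<open>0\<close> stand for the product, the inverse and the identity of \<open>G\<close>.
  Locally compact groups are Hausdorff, and measurability is Borel measurability.
\<close>

text \<open>A left Haar measure is a nonzero left-invariant Radon measure on the Borel sets.\<close>

definition left_haar_measure :: "'a :: {topological_group_add, t2_space} measure \<Rightarrow> bool" where
  "left_haar_measure \<mu> \<longleftrightarrow>
     sets \<mu> = sets borel \<and>
     emeasure \<mu> UNIV \<noteq> 0 \<and>
     (\<forall>K. compact K \<longrightarrow> emeasure \<mu> K < \<infinity>) \<and>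
     (\<forall>A\<in>sets borel. emeasure \<mu> A = (INF U\<in>{U. open U \<and> A \<subseteq> U}. emeasure \<mu> U)) \<and>
     (\<forall>U. open U \<longrightarrow> emeasure \<mu> U = (SUP K\<in>{K. compact K \<and> K \<subseteq> U}. emeasure \<mu> K)) \<and>
     (\<forall>s. \<forall>A\<in>sets borel. emeasure \<mu> ((\<lambda>t. s + t) ` A) = emeasure \<mu> A)"

definition weight :: "('a :: topological_space \<Rightarrow> real) \<Rightarrow> bool" where
  "weight \<omega> \<longleftrightarrow> \<omega> \<in> borel_measurable borel \<and> (\<forall>t. 0 < \<omega> t)"

definition locally_p_integrable ::
    "'a :: topological_space measure \<Rightarrow> real \<Rightarrow> ('a \<Rightarrow> real) \<Rightarrow> bool" where
  "locally_p_integrable \<mu> p \<omega> \<longleftrightarrow>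
     (\<forall>K. compact K \<longrightarrow> (\<integral>\<^sup>+ t\<in>K. ennreal (\<omega> t powr p) \<partial>\<mu>) < \<infinity>)"

definition admissible ::
    "'a :: topological_group_add measure \<Rightarrow> 'a set \<Rightarrow> ('a \<Rightarrow> real) \<Rightarrow> bool" where
  "admissible \<mu> S \<omega> \<longleftrightarrow> (\<forall>s\<in>S. esssup \<mu> (\<lambda>t. ereal (\<omega> (s + t) / \<omega> t)) < \<infinity>)"

text \<open>
  Elements of $L^p(G,\omega)$ are represented by functions, without passing to classes modulo
  almost everywhere equality; the norm is then a seminorm on representatives, and density
  with respect to it is density in the quotient.
\<close>

definition weighted_Lp ::
    "'a :: topological_space measure \<Rightarrow> real \<Rightarrow> ('a \<Rightarrow> real) \<Rightarrow> ('a \<Rightarrow> complex) set" where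
  "weighted_Lp \<mu> p \<omega> =
     {f \<in> borel_measurable \<mu>. (\<integral>\<^sup>+ t. ennreal (cmod (f t) powr p * \<omega> t powr p) \<partial>\<mu>) < \<infinity>}"

definition weighted_Lp_norm ::
    "'a :: topological_space measure \<Rightarrow> real \<Rightarrow> ('a \<Rightarrow> real) \<Rightarrow> ('a \<Rightarrow> complex) \<Rightarrow> real" where
  "weighted_Lp_norm \<mu> p \<omega> f = (LINT t|\<mu>. cmod (f t) powr p * \<omega> t powr p) powr (1 / p)"

definition dense_in_weighted_Lp ::
    "'a :: topological_space measure \<Rightarrow> real \<Rightarrow> ('a \<Rightarrow> real) \<Rightarrow> ('a \<Rightarrow> complex) set \<Rightarrow> bool" where
  "dense_in_weighted_Lp \<mu> p \<omega> A \<longleftrightarrow>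
     A \<subseteq> weighted_Lp \<mu> p \<omega> \<and>
     (\<forall>g\<in>weighted_Lp \<mu> p \<omega>. \<forall>\<epsilon>>0. \<exists>h\<in>A. weighted_Lp_norm \<mu> p \<omega> (\<lambda>t. h t - g t) < \<epsilon>)"

definition left_translation :: "'a :: group_add \<Rightarrow> ('a \<Rightarrow> complex) \<Rightarrow> 'a \<Rightarrow> complex" where
  "left_translation s f = (\<lambda>t. f (- s + t))"

definition S_dense_vector ::
    "'a :: topological_group_add measure \<Rightarrow> real \<Rightarrow> ('a \<Rightarrow> real) \<Rightarrow> 'a set \<Rightarrow>
       ('a \<Rightarrow> complex) \<Rightarrow> bool" where
  "S_dense_vector \<mu> p \<omega> S f \<longleftrightarrow>
     f \<in> weighted_Lp \<mu> p \<omega> \<and> dense_in_weighted_Lp \<mu> p \<omega> {left_translation s f | s. s \<in> S}"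

definition Gamma_S_dense_vector ::
    "'a :: topological_group_add measure \<Rightarrow> real \<Rightarrow> ('a \<Rightarrow> real) \<Rightarrow> complex set \<Rightarrow> 'a set \<Rightarrow>
       ('a \<Rightarrow> complex) \<Rightarrow> bool" where
  "Gamma_S_dense_vector \<mu> p \<omega> \<Gamma> S f \<longleftrightarrow>
     f \<in> weighted_Lp \<mu> p \<omega> \<and>
     dense_in_weighted_Lp \<mu> p \<omega>
       {(\<lambda>t. c * left_translation s f t) | c s. c \<in> \<Gamma> \<and> s \<in> S}"

end

theory Submission
  imports Defs
begin

text \<open>
  Pass to the measure \<open>\<nu> = \<omega>\<^sup>p \<mu>\<close>, let \<open>f\<close> be \<open>(\<Gamma>, S)\<close>-dense and let \<open>\<phi>\<^sub>n\<close> run infinitely often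
  through a countable dense set of bounded functions with supports of finite measure.
  Approximating a large multiple of the indicator of a set \<open>F\<^sub>n\<close> that contains the support of \<open>\<phi>\<^sub>n\<close>
  gives \<open>s\<^sub>n \<in> S\<close> and a level band \<open>A\<^sub>n = {a\<^sub>n < \<bar>f\<bar> \<le> b\<^sub>n}\<close> such that \<open>s\<^sub>n A\<^sub>n\<close> covers almost all
  of \<open>F\<^sub>n\<close> while \<open>s\<^sub>n {1 \<le> \<bar>f\<bar> \<le> a\<^sub>n}\<close> is almost null; this is where the two bounds on
  \<open>\<Gamma>\<close> enter.  With \<open>b\<^sub>n \<le> a\<^sub>n\<^sub>+\<^sub>1\<close> the bands are disjoint, and since \<open>f \<in> L\<^sup>p\<close> their measures decay
  as fast as desired when \<open>a\<^sub>n\<close> grows.  The function equal to \<open>t \<mapsto> \<phi>\<^sub>n (s\<^sub>n t)\<close> on \<open>A\<^sub>n\<close> and to \<open>0\<close>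
  elsewhere is \<open>S\<close>-dense: its translate by \<open>s\<^sub>k\<close> differs from \<open>\<phi>\<^sub>k\<close> only off \<open>s\<^sub>k A\<^sub>k\<close>, where the
  earlier bands are almost null by construction and the later ones by admissibility.
\<close>

subsection \<open>Approximation in measure\<close>

text \<open>Iterate countably often the step that adds all values of \<open>f\<close>; the stages
  increase, so two elements of the union already lie in a common stage. It is applied to an
  operation on sets and to pointwise addition of functions.\<close>

lemma countable_closed_superset:
  assumes "countable X"
  obtains Y where "countable Y" "X \<subseteq> Y" "\<And>a b. a \<in> Y \<Longrightarrow> b \<in> Y \<Longrightarrow> f a b \<in> Y"
proof -
  define step where "step = (\<lambda>Z. Z \<union> case_prod f ` (Z \<times> Z))"
  define Y where "Y = (\<Union>n. (step ^^ n) X)"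
  have "countable ((step ^^ n) X)" for n
    by (induction n) (auto simp: assms step_def)
  then have 1: "countable Y"
    unfolding Y_def by blast
  have "(step ^^ 0) X \<subseteq> Y"
    unfolding Y_def by blast
  then have 2: "X \<subseteq> Y"
    by simp
  have "incseq (\<lambda>n. (step ^^ n) X)"
    by (rule incseq_SucI) (simp add: step_def)
  then have mono: "(step ^^ m) X \<subseteq> (step ^^ n) X" if "m \<le> n" for m n
    using that by (auto simp: incseq_def)
  have 3: "f a b \<in> Y" if ab: "a \<in> Y" "b \<in> Y" for a b
  proof -
    obtain m n where "a \<in> (step ^^ m) X" "b \<in> (step ^^ n) X"
      using ab unfolding Y_def by blast
    then have "a \<in> (step ^^ max m n) X" "b \<in> (step ^^ max m n) X"
      using mono by (meson max.cobounded1 max.cobounded2 subsetD)+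
    then have "f a b \<in> (step ^^ Suc (max m n)) X"
      by (force simp: step_def)
    then show ?thesis
      unfolding Y_def by blast
  qed
  show ?thesis
    by (rule that[OF 1 2 3])
qed

text \<open>The approximable sets form a \<sigma>-algebra. A symmetric difference is unchanged by
  taking complements, and a countable union is within \<open>\<epsilon>/2\<close> of a finite one by
  continuity from below, which is where finiteness of the measure enters.\<close>

lemma algebra_approximates_sigma_sets:
  assumes "finite_measure M" and "algebra (space M) \<A>"
    and sets: "sets M = sigma_sets (space M) \<A>"
    and "E \<in> sets M" and "\<epsilon> > 0"
  shows "\<exists>A\<in>\<A>. measure M (sym_diff E A) < \<epsilon>"
proof -
  interpret finite_measure M by fact
  interpret algebra "space M" \<A> by fact
  have meas: "A \<in> sets M" if "A \<in> \<A>" for A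
    using that sets by (auto intro: sigma_sets.Basic)
  have "E \<in> sigma_sets (space M) \<A>"
    using assms by simp
  then show ?thesis using \<open>\<epsilon> > 0\<close>
  proof (induction arbitrary: \<epsilon>)
    case (Basic a)
    then show ?case by (intro bexI[of _ a]) auto
  next
    case Empty
    then show ?case by (intro bexI[of _ "{}"]) auto
  next
    case (Compl a)
    then obtain A where A: "A \<in> \<A>" "measure M (sym_diff a A) < \<epsilon>"
      by blast
    have "A \<subseteq> space M" "a \<subseteq> space M"
      using A(1) Compl(1) meas sets sets.sets_into_space by blast+
    then have "sym_diff (space M - a) (space M - A) = sym_diff a A"
      by blast
    with A show ?case
      by (intro bexI[of _ "space M - A"]) auto
  next
    case (Union a)
    have am: "a i \<in> sets M" for i
      using Union(1) sets by simp
    have "(\<lambda>n. measure M (\<Union>i<n. a i)) \<longlonglongrightarrow> measure M (\<Union>n. \<Union>i<n. a i)"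
      using am by (intro finite_Lim_measure_incseq) (auto simp: incseq_def; force)+
    moreover have "(\<Union>n. \<Union>i<n. a i) = (\<Union>i. a i)"
      by auto
    ultimately have "(\<lambda>n. measure M (\<Union>i<n. a i)) \<longlonglongrightarrow> measure M (\<Union>i. a i)"
      by simp
    then have "eventually (\<lambda>n. measure M (\<Union>i. a i) - \<epsilon>/2 < measure M (\<Union>i<n. a i)) sequentially"
      by (rule order_tendstoD) (use Union.prems in simp)
    then obtain N where N: "measure M (\<Union>i. a i) - \<epsilon>/2 < measure M (\<Union>i<N. a i)"
      by (auto simp: eventually_sequentially)
    have diff: "measure M ((\<Union>i. a i) - (\<Union>i<N. a i)) < \<epsilon>/2"
      using N am by (subst finite_measure_Diff) auto
    \<comment> \<open>Dividing by \<open>N + 1\<close> instead of \<open>N\<close> keeps the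
      tolerance positive when \<open>N = 0\<close>.\<close>
    have "\<exists>A\<in>\<A>. measure M (sym_diff (a i) A) < \<epsilon> / 2 / (N + 1)" for i
      using Union by (intro Union.IH) auto
    then obtain A where A: "\<And>i. A i \<in> \<A>" "\<And>i. measure M (sym_diff (a i) (A i)) < \<epsilon> / 2 / (N + 1)"
      by metis
    have Am: "A i \<in> sets M" for i
      using A meas by blast
    have "measure M (sym_diff (\<Union>i. a i) (\<Union>i<N. A i))
        \<le> measure M (((\<Union>i. a i) - (\<Union>i<N. a i)) \<union> (\<Union>i<N. sym_diff (a i) (A i)))"
      using am Am by (intro finite_measure_mono) (auto intro!: sets.countable_UN)
    also have "\<dots> \<le> measure M ((\<Union>i. a i) - (\<Union>i<N. a i)) + measure M (\<Union>i<N. sym_diff (a i) (A i))"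
      using am Am by (intro measure_Un_le) auto
    also have "measure M (\<Union>i<N. sym_diff (a i) (A i)) \<le> (\<Sum>i<N. measure M (sym_diff (a i) (A i)))"
      using am Am by (intro finite_measure_subadditive_finite) auto
    also have "\<dots> \<le> (\<Sum>i<N. \<epsilon> / 2 / (N + 1))"
      using A(2) by (intro sum_mono less_imp_le)
    also have "\<dots> \<le> \<epsilon> / 2"
      using Union.prems by (simp add: field_simps)
    finally have "measure M (sym_diff (\<Union>i. a i) (\<Union>i<N. A i)) < \<epsilon>"
      using diff by linarith
    then show ?case
      using A(1) by (intro bexI[of _ "\<Union>i<N. A i"]) auto
  qed
qed

section \<open>The p-th power integral and Chebyshev's inequality\<close>

text \<open>The \<open>p\<close>-th power of the norm, which only satisfies the triangle inequality up to a factor.\<close>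

definition pint :: "'a measure \<Rightarrow> real \<Rightarrow> ('a \<Rightarrow> complex) \<Rightarrow> ennreal" where
  "pint M p h = (\<integral>\<^sup>+x. ennreal (cmod (h x) powr p) \<partial>M)"

text \<open>The sum is at most twice the maximum, and the p-th power of the maximum is one of the
  two summands on the right.\<close>

lemma powr_add_le:
  fixes a b p :: real
  assumes "0 \<le> a" "0 \<le> b" "0 \<le> p"
  shows "(a + b) powr p \<le> 2 powr p * (a powr p + b powr p)"
proof -
  have "(a + b) powr p \<le> (2 * max a b) powr p"
    using assms by (intro powr_mono2) auto
  also have "\<dots> = 2 powr p * max a b powr p"
    using assms by (simp add: powr_mult)
  also have "\<dots> \<le> 2 powr p * (a powr p + b powr p)"
    by (intro mult_left_mono) (auto simp: max_def)
  finally show ?thesis .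
qed

lemma pint_add_le:
  assumes [measurable]: "h \<in> borel_measurable M" "k \<in> borel_measurable M" and "0 \<le> p"
  shows "pint M p (\<lambda>x. h x + k x) \<le> ennreal (2 powr p) * (pint M p h + pint M p k)"
proof -
  have "cmod (h x + k x) powr p \<le> 2 powr p * (cmod (h x) powr p + cmod (k x) powr p)" for x
    using powr_mono2[OF \<open>0 \<le> p\<close> norm_ge_zero norm_triangle_ineq[of "h x" "k x"]]
      powr_add_le[of "cmod (h x)" "cmod (k x)" p] \<open>0 \<le> p\<close> by simp
  then have "pint M p (\<lambda>x. h x + k x)
      \<le> (\<integral>\<^sup>+x. ennreal (2 powr p) * (ennreal (cmod (h x) powr p) + ennreal (cmod (k x) powr p)) \<partial>M)"
    unfolding pint_def
    by (intro nn_integral_mono) (simp add: ennreal_leI flip: ennreal_plus ennreal_mult)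
  also have "\<dots> = ennreal (2 powr p) * (pint M p h + pint M p k)"
    unfolding pint_def by (subst nn_integral_cmult, measurable, subst nn_integral_add) auto
  finally show ?thesis .
qed

lemma pint_uminus: "pint M p (\<lambda>x. - h x) = pint M p h"
  by (simp add: pint_def)

lemma pint_diff_le:
  assumes "h \<in> borel_measurable M" "k \<in> borel_measurable M" "l \<in> borel_measurable M" and "0 \<le> p"
  shows "pint M p (\<lambda>x. h x - l x)
    \<le> ennreal (2 powr p) * (pint M p (\<lambda>x. h x - k x) + pint M p (\<lambda>x. k x - l x))"
  using pint_add_le[of "\<lambda>x. h x - k x" M "\<lambda>x. k x - l x" p] assms by simp

lemma pint_mult:
  assumes [measurable]: "h \<in> borel_measurable M"
  shows "pint M p (\<lambda>x. c * h x) = ennreal (cmod c powr p) * pint M p h"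
  unfolding pint_def by (subst nn_integral_cmult[symmetric]) (auto simp: norm_mult powr_mult ennreal_mult)

lemma pint_cong: "(\<And>x. x \<in> space M \<Longrightarrow> h x = k x) \<Longrightarrow> pint M p h = pint M p k"
  unfolding pint_def by (auto intro!: nn_integral_cong)

lemma pint_indicator:
  assumes "E \<in> sets M"
  shows "pint M p (\<lambda>x. c * indicator E x) = ennreal (cmod c powr p) * emeasure M E"
proof -
  have "pint M p (\<lambda>x. c * indicator E x) = (\<integral>\<^sup>+x. ennreal (cmod c powr p) * indicator E x \<partial>M)"
    unfolding pint_def by (intro nn_integral_cong) (auto simp: indicator_def)
  with assms show ?thesis
    by (simp add: nn_integral_cmult)
qed

text \<open>Chebyshev's inequality, which turns smallness in the norm into smallness of an
  exceptional set.\<close>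

lemma pint_Markov:
  assumes [measurable]: "h \<in> borel_measurable M" and "0 < d" "0 \<le> p"
  shows "emeasure M {x\<in>space M. d \<le> cmod (h x)} \<le> ennreal ((1 / d) powr p) * pint M p h"
proof -
  have "{x\<in>space M. d \<le> cmod (h x)} \<subseteq>
      {x\<in>space M. 1 \<le> ennreal ((1 / d) powr p) * ennreal (cmod (h x) powr p)}"
  proof safe
    fix x assume "d \<le> cmod (h x)"
    then have "1 \<le> (cmod (h x) / d) powr p"
      using assms by (intro ge_one_powr_ge_zero) auto
    also have "\<dots> = (1 / d) powr p * cmod (h x) powr p"
      using assms by (simp add: powr_divide)
    finally show "1 \<le> ennreal ((1 / d) powr p) * ennreal (cmod (h x) powr p)"
      by (metis ennreal_1 ennreal_leI ennreal_mult powr_ge_zero)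
  qed
  then have "emeasure M {x\<in>space M. d \<le> cmod (h x)} \<le>
      emeasure M {x\<in>space M. 1 \<le> ennreal ((1 / d) powr p) * ennreal (cmod (h x) powr p)}"
    by (rule emeasure_mono) measurable
  also have "\<dots> \<le> ennreal ((1 / d) powr p) * pint M p h"
    using nn_integral_Markov_inequality[of "\<lambda>x. ennreal (cmod (h x) powr p)" "space M" M
        "ennreal ((1 / d) powr p)"] by (simp add: pint_def cong: nn_integral_cong)
  finally show ?thesis .
qed

lemma ennreal_pos_imp_real_le:
  assumes "0 < (\<epsilon> :: ennreal)"
  obtains e :: real where "0 < e" "ennreal e \<le> \<epsilon>"
proof (cases \<epsilon>)
  case (real r)
  with assms show ?thesis by (intro that[of r]) auto
next
  case top
  then show ?thesis by (intro that[of 1]) auto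
qed

section \<open>Separability of L^p\<close>

text \<open>A countably generated \<sigma>-algebra is approximated by a countable algebra.
  \<open>D\<close> contains the finite sums of \<open>q\<close> times the indicator of
  \<open>A \<inter> W n\<close>, with \<open>q\<close> from a countable dense set of scalars,
  \<open>A\<close> from the algebra and \<open>W n\<close> exhausting the space by sets of finite
  measure. Bounded values and supports of finite measure are kept because the later construction
  needs both.\<close>

lemma countable_dense_pint:
  assumes "sigma_finite_measure M" and "countable \<G>"
    and sets: "sets M = sigma_sets (space M) \<G>" and p: "1 \<le> p"
  obtains D where "countable D" "D \<noteq> {}" "D \<subseteq> borel_measurable M"
    and "\<And>d. d \<in> D \<Longrightarrow> bounded (range d)"
    and "\<And>d. d \<in> D \<Longrightarrow> emeasure M {x\<in>space M. d x \<noteq> 0} < \<infinity>"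
    and "\<And>h \<epsilon>. h \<in> borel_measurable M \<Longrightarrow> pint M p h < \<infinity> \<Longrightarrow> 0 < \<epsilon> \<Longrightarrow>
        \<exists>d\<in>D. pint M p (\<lambda>x. d x - h x) < \<epsilon>"
proof -
  interpret sigma_finite_measure M by fact
  obtain W :: "nat \<Rightarrow> 'a set" where W: "range W \<subseteq> sets M" "(\<Union>i. W i) = space M"
    "\<And>i. emeasure M (W i) \<noteq> \<infinity>" "incseq W"
    using sigma_finite_incseq by blast
  have Wm[measurable]: "W i \<in> sets M" for i using W by auto
  \<comment> \<open>The single operation "complement of the union" suffices for an algebra: equal
    arguments give complements, and the complement of its value gives the union.\<close>
  obtain \<A> where \<A>: "countable \<A>" "insert {} \<G> \<subseteq> \<A>"
    and nor: "\<And>A B. A \<in> \<A> \<Longrightarrow> B \<in> \<A> \<Longrightarrow> space M - (A \<union> B) \<in> \<A>"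
    using countable_closed_superset[of "insert {} \<G>" "\<lambda>A B. space M - (A \<union> B)"] \<open>countable \<G>\<close>
    by auto
  \<comment> \<open>The closed superset is only known to be countable and may contain sets that are
    not measurable; the intersection removes them and keeps the closure property. \<open>D\<close>
    is cut down from \<open>D1\<close> below for the same reason.\<close>
  define \<B> where "\<B> = \<A> \<inter> sets M"
  have nor': "space M - (A \<union> B) \<in> \<B>" if "A \<in> \<B>" "B \<in> \<B>" for A B
    using that nor by (auto simp: \<B>_def)
  have alg: "algebra (space M) \<B>"
    unfolding algebra_iff_Un
  proof (intro conjI ballI)
    show "\<B> \<subseteq> Pow (space M)" using sets.space_closed by (auto simp: \<B>_def)
    show "{} \<in> \<B>" using \<A> by (auto simp: \<B>_def)
    show 1: "space M - A \<in> \<B>" if "A \<in> \<B>" for A using nor'[OF that that] by simp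
    show "A \<union> B \<in> \<B>" if "A \<in> \<B>" "B \<in> \<B>" for A B
    proof -
      have "A \<union> B = space M - (space M - (A \<union> B))"
        using that sets.sets_into_space by (auto simp: \<B>_def)
      then show ?thesis using 1[OF nor'[OF that]] by simp
    qed
  qed
  have genB: "sets M = sigma_sets (space M) \<B>"
  proof (rule antisym)
    show "sets M \<subseteq> sigma_sets (space M) \<B>"
      unfolding sets using \<A> sets by (intro sigma_sets_mono') (auto simp: \<B>_def)
    show "sigma_sets (space M) \<B> \<subseteq> sets M"
      by (intro sets.sigma_sets_subset) (auto simp: \<B>_def)
  qed
  obtain Q :: "complex set" where Q: "countable Q" "\<And>X. open X \<Longrightarrow> X \<noteq> {} \<Longrightarrow> \<exists>d\<in>Q. d \<in> X"
    using countable_dense_setE by blast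
  define D0 where "D0 = (\<lambda>(q, A, n) x. q * indicator (A \<inter> W n) x) ` (Q \<times> \<B> \<times> (UNIV :: nat set))"
  define G where "G = {d :: 'a \<Rightarrow> complex. d \<in> borel_measurable M \<and> bounded (range d) \<and>
    emeasure M {x\<in>space M. d x \<noteq> 0} < \<infinity>}"
  have D0: "insert (\<lambda>x. 0) D0 \<subseteq> G"
  proof -
    have "(\<lambda>x. q * indicator (A \<inter> W n) x) \<in> G" if "A \<in> \<B>" for q A n
    proof -
      have [measurable]: "A \<in> sets M" using that by (simp add: \<B>_def)
      have "emeasure M {x\<in>space M. q * indicator (A \<inter> W n) x \<noteq> 0} \<le> emeasure M (W n)"
        by (rule emeasure_mono) (auto simp: indicator_def)
      also have "\<dots> < \<infinity>" using W(3) by (simp add: top.not_eq_extremum)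
      finally have "emeasure M {x\<in>space M. q * indicator (A \<inter> W n) x \<noteq> 0} < \<infinity>" .
      moreover have "bounded (range (\<lambda>x. q * indicator (A \<inter> W n) x))"
        by (rule boundedI[of _ "cmod q"]) (auto simp: indicator_def)
      ultimately show ?thesis by (simp add: G_def)
    qed
    then show ?thesis by (auto simp: D0_def) (simp add: G_def)
  qed
  have Gplus: "(\<lambda>x. d x + e x) \<in> G" if "d \<in> G" "e \<in> G" for d e
  proof -
    have [measurable]: "d \<in> borel_measurable M" "e \<in> borel_measurable M"
      using that by (auto simp: G_def)
    have "emeasure M {x\<in>space M. d x + e x \<noteq> 0} \<le>
        emeasure M ({x\<in>space M. d x \<noteq> 0} \<union> {x\<in>space M. e x \<noteq> 0})"
      by (rule emeasure_mono) auto
    also have "\<dots> \<le> emeasure M {x\<in>space M. d x \<noteq> 0} + emeasure M {x\<in>space M. e x \<noteq> 0}"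
      by (rule emeasure_subadditive) auto
    also have "\<dots> < \<infinity>" using that by (simp add: G_def)
    finally show ?thesis
      using that bounded_plus_comp[of d UNIV e] by (auto simp: G_def)
  qed
  have "countable (insert (\<lambda>x. 0) D0)"
    using Q \<A> by (auto simp: D0_def \<B>_def)
  then obtain D1 where D1: "countable D1" "insert (\<lambda>x. 0) D0 \<subseteq> D1"
    and D1p: "\<And>d e. d \<in> D1 \<Longrightarrow> e \<in> D1 \<Longrightarrow> (\<lambda>x. d x + e x) \<in> D1"
    using countable_closed_superset[of _ "\<lambda>d e x. d x + e x"] by metis
  define D where "D = D1 \<inter> G"
  have Dp: "(\<lambda>x. d x + e x) \<in> D" if "d \<in> D" "e \<in> D" for d e
    using that D1p Gplus by (auto simp: D_def)
  have D0D: "insert (\<lambda>x. 0) D0 \<subseteq> D"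
    using D0 D1 by (auto simp: D_def)
  have Dm: "d \<in> borel_measurable M" if "d \<in> D" for d
    using that by (auto simp: D_def G_def)

  \<comment> \<open>\<open>C\<close> is the closure of \<open>D\<close>. It is closed under sums and
    limits, and the inclusions climb from indicators inside some \<open>W n\<close> to indicators of
    sets of finite measure, to simple functions, to all functions with finite integral.\<close>
  define C where "C = {h \<in> borel_measurable M. \<forall>\<epsilon>>0. \<exists>d\<in>D. pint M p (\<lambda>x. d x - h x) < ennreal \<epsilon>}"
  have C_add: "(\<lambda>x. h x + k x) \<in> C" if "h \<in> C" "k \<in> C" for h k
  proof -
    have hk[measurable]: "h \<in> borel_measurable M" "k \<in> borel_measurable M"
      using that by (auto simp: C_def)
    have "\<exists>d\<in>D. pint M p (\<lambda>x. d x - (h x + k x)) < ennreal \<epsilon>" if "\<epsilon> > 0" for \<epsilon>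
    proof -
      \<comment> \<open>Two errors below \<open>\<eta>\<close> add up to less than
        \<open>\<epsilon>\<close> after the factor \<open>2 powr p\<close> of the quasi-triangle
        inequality. The same choice recurs below.\<close>
      define \<eta> where "\<eta> = \<epsilon> / (2 powr p * 2)"
      have \<eta>: "\<eta> > 0" using that by (simp add: \<eta>_def)
      obtain d e where de: "d \<in> D" "e \<in> D" "pint M p (\<lambda>x. d x - h x) < ennreal \<eta>"
          "pint M p (\<lambda>x. e x - k x) < ennreal \<eta>"
        using \<open>h \<in> C\<close> \<open>k \<in> C\<close> \<eta> by (auto simp: C_def) blast
      note [measurable] = Dm[OF de(1)] Dm[OF de(2)]
      have "pint M p (\<lambda>x. (d x + e x) - (h x + k x)) = pint M p (\<lambda>x. (d x - h x) + (e x - k x))"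
        by (simp add: algebra_simps)
      also have "\<dots> \<le> ennreal (2 powr p) * (pint M p (\<lambda>x. d x - h x) + pint M p (\<lambda>x. e x - k x))"
        using p by (intro pint_add_le) auto
      also have "\<dots> < ennreal (2 powr p) * (ennreal \<eta> + ennreal \<eta>)"
        using de by (intro ennreal_mult_strict_left_mono add_strict_mono) auto
      also have "\<dots> = ennreal \<epsilon>"
        using \<eta> by (simp add: \<eta>_def flip: ennreal_plus ennreal_mult)
      finally show ?thesis using Dp[OF de(1,2)] by (intro bexI[of _ "\<lambda>x. d x + e x"])
    qed
    then show ?thesis by (simp add: C_def)
  qed
  have C_lim: "h \<in> C" if [measurable]: "h \<in> borel_measurable M" and "\<And>i. u i \<in> C"
    and "(\<lambda>i. pint M p (\<lambda>x. u i x - h x)) \<longlonglongrightarrow> 0" for h and u :: "nat \<Rightarrow> _"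
  proof -
    have [measurable]: "u i \<in> borel_measurable M" for i
      using that by (auto simp: C_def)
    have "\<exists>d\<in>D. pint M p (\<lambda>x. d x - h x) < ennreal \<epsilon>" if "\<epsilon> > 0" for \<epsilon>
    proof -
      define \<eta> where "\<eta> = \<epsilon> / (2 powr p * 2)"
      have \<eta>: "\<eta> > 0" using that by (simp add: \<eta>_def)
      have "eventually (\<lambda>i. pint M p (\<lambda>x. u i x - h x) < ennreal \<eta>) sequentially"
        by (rule order_tendstoD[OF \<open>(\<lambda>i. pint M p (\<lambda>x. u i x - h x)) \<longlonglongrightarrow> 0\<close>]) (use \<eta> in simp)
      then obtain i where i: "pint M p (\<lambda>x. u i x - h x) < ennreal \<eta>"
        by (auto simp: eventually_sequentially)
      obtain d where d: "d \<in> D" "pint M p (\<lambda>x. d x - u i x) < ennreal \<eta>"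
        using \<open>u i \<in> C\<close> \<eta> by (auto simp: C_def)
      note [measurable] = Dm[OF d(1)]
      have "pint M p (\<lambda>x. d x - h x)
          \<le> ennreal (2 powr p) * (pint M p (\<lambda>x. d x - u i x) + pint M p (\<lambda>x. u i x - h x))"
        using p by (intro pint_diff_le) auto
      also have "\<dots> < ennreal (2 powr p) * (ennreal \<eta> + ennreal \<eta>)"
        using d i by (intro ennreal_mult_strict_left_mono add_strict_mono) auto
      also have "\<dots> = ennreal \<epsilon>"
        using \<eta> by (simp add: \<eta>_def flip: ennreal_plus ennreal_mult)
      finally show ?thesis using d by blast
    qed
    then show ?thesis by (simp add: C_def)
  qed
  have C_ind0: "(\<lambda>x. c * indicator (E \<inter> W n) x) \<in> C" if [measurable]: "E \<in> sets M" for c E n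
  proof -
    have "\<exists>d\<in>D. pint M p (\<lambda>x. d x - c * indicator (E \<inter> W n) x) < ennreal \<epsilon>" if "\<epsilon> > 0" for \<epsilon>
    proof -
      define \<eta> where "\<eta> = \<epsilon> / (2 powr p * 2)"
      have \<eta>: "\<eta> > 0" using that by (simp add: \<eta>_def)
      define m where "m = measure M (W n)"
      have Wn: "emeasure M (W n) = ennreal m"
        using W(3)[of n] by (simp add: m_def emeasure_eq_ennreal_measure)
      \<comment> \<open>\<open>r \<le> 1\<close> gives \<open>r powr p \<le> r\<close> because
        \<open>1 \<le> p\<close>, and the other bound makes \<open>r * m < \<eta>\<close>; the
        summand 1 in \<open>m + 1\<close> covers \<open>m = 0\<close>.\<close>
      define r where "r = min 1 (\<eta> / (m + 1))"
      have m0: "m \<ge> 0" by (simp add: m_def)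
      have r: "r > 0" "r \<le> 1" "r * m < \<eta>"
      proof -
        show "r > 0" "r \<le> 1" using \<eta> m0 by (auto simp: r_def)
        have "r * m \<le> \<eta> / (m + 1) * m" using m0 by (intro mult_right_mono) (auto simp: r_def)
        also have "\<dots> < \<eta>" using \<eta> m0 by (simp add: field_simps)
        finally show "r * m < \<eta>" .
      qed
      obtain q where q: "q \<in> Q" "q \<in> ball c r"
        using Q(2)[of "ball c r"] r by auto
      have qc: "cmod (q - c) powr p \<le> r"
      proof -
        have "cmod (q - c) \<le> r" using q by (simp add: dist_norm norm_minus_commute)
        then have "cmod (q - c) powr p \<le> r powr p" using p by (intro powr_mono2) auto
        also have "\<dots> \<le> r powr 1" using p r by (intro powr_mono') auto
        finally show ?thesis using r by simp
      qed
      \<comment> \<open>\<open>N\<close> is \<open>M\<close> restricted to \<open>W n\<close>, a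
        finite measure, as the approximation by an algebra requires. In the tolerance below, the
        summand 1 covers \<open>q = 0\<close>.\<close>
      define N where "N = density M (indicator (W n))"
      have N: "finite_measure N"
        by (rule finite_measureI) (use W(3) in \<open>simp add: N_def emeasure_density cong: nn_integral_cong\<close>)
      have "\<exists>A\<in>\<B>. measure N (sym_diff E A) < \<eta> / (cmod q powr p + 1)"
      proof (rule algebra_approximates_sigma_sets[OF N])
        show "algebra (space N) \<B>" "sets N = sigma_sets (space N) \<B>" "E \<in> sets N"
          using alg genB \<open>E \<in> sets M\<close> by (simp_all add: N_def)
        show "\<eta> / (cmod q powr p + 1) > 0"
          using \<eta> by (simp add: add_nonneg_pos)
      qed
      then obtain A where A: "A \<in> \<B>" "measure N (sym_diff E A) < \<eta> / (cmod q powr p + 1)"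
        by blast
      have [measurable]: "A \<in> sets M" using A by (simp add: \<B>_def)
      have "emeasure M (sym_diff E A \<inter> W n) = emeasure N (sym_diff E A)"
        by (simp add: N_def emeasure_density Int_commute flip: indicator_inter_arith)
      also have "\<dots> < ennreal (\<eta> / (cmod q powr p + 1))"
        using A \<eta> finite_measure.emeasure_eq_measure[OF N] by (simp add: ennreal_less_iff)
      finally have ES: "emeasure M (sym_diff E A \<inter> W n) < ennreal (\<eta> / (cmod q powr p + 1))" .
      have "pint M p (\<lambda>x. q * indicator (A \<inter> W n) x - c * indicator (E \<inter> W n) x)
          \<le> ennreal (2 powr p) * (pint M p (\<lambda>x. q * indicator (A \<inter> W n) x - q * indicator (E \<inter> W n) x)
            + pint M p (\<lambda>x. q * indicator (E \<inter> W n) x - c * indicator (E \<inter> W n) x))"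
        using p by (intro pint_diff_le) auto
      also have "\<dots> < ennreal (2 powr p) * (ennreal \<eta> + ennreal \<eta>)"
      proof (intro ennreal_mult_strict_left_mono add_strict_mono)
        have "pint M p (\<lambda>x. q * indicator (A \<inter> W n) x - q * indicator (E \<inter> W n) x)
          = pint M p (\<lambda>x. q * indicator (sym_diff E A \<inter> W n) x)"
          unfolding pint_def by (intro nn_integral_cong) (auto simp: indicator_def)
        also have "\<dots> = ennreal (cmod q powr p) * emeasure M (sym_diff E A \<inter> W n)"
          by (intro pint_indicator) auto
        also have "\<dots> \<le> ennreal (cmod q powr p) * ennreal (\<eta> / (cmod q powr p + 1))"
          using ES by (intro mult_left_mono) auto
        also have "\<dots> = ennreal (cmod q powr p * \<eta> / (cmod q powr p + 1))"
          by (simp flip: ennreal_mult')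
        also have "\<dots> < ennreal \<eta>"
          using \<eta> by (intro ennreal_lessI) (auto simp: field_simps add_pos_nonneg)
        finally show "pint M p (\<lambda>x. q * indicator (A \<inter> W n) x - q * indicator (E \<inter> W n) x) < ennreal \<eta>" .
        have "pint M p (\<lambda>x. q * indicator (E \<inter> W n) x - c * indicator (E \<inter> W n) x)
            = pint M p (\<lambda>x. (q - c) * indicator (E \<inter> W n) x)"
          by (simp add: algebra_simps)
        also have "\<dots> = ennreal (cmod (q - c) powr p) * emeasure M (E \<inter> W n)"
          by (intro pint_indicator) auto
        also have "\<dots> \<le> ennreal r * emeasure M (W n)"
          using qc by (intro mult_mono emeasure_mono ennreal_leI) auto
        also have "\<dots> = ennreal (r * m)" using Wn r by (simp add: ennreal_mult')
        also have "\<dots> < ennreal \<eta>" using r \<eta> by (intro ennreal_lessI) auto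
        finally show "pint M p (\<lambda>x. q * indicator (E \<inter> W n) x - c * indicator (E \<inter> W n) x) < ennreal \<eta>" .
      qed auto
      also have "\<dots> = ennreal \<epsilon>"
        using \<eta> by (simp add: \<eta>_def flip: ennreal_plus ennreal_mult)
      finally have "pint M p (\<lambda>x. q * indicator (A \<inter> W n) x - c * indicator (E \<inter> W n) x) < ennreal \<epsilon>" .
      moreover have "(\<lambda>x. q * indicator (A \<inter> W n) x) \<in> D0"
        unfolding D0_def using q(1) A(1) by (intro image_eqI[of _ _ "(q, A, n)"]) auto
      ultimately show ?thesis
        using D0D by (intro bexI[of _ "\<lambda>x. q * indicator (A \<inter> W n) x"]) auto
    qed
    then show ?thesis by (simp add: C_def)
  qed
  have C_ind: "(\<lambda>x. c * indicator E x) \<in> C" if [measurable]: "E \<in> sets M" and "emeasure M E < \<infinity>" for c E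
  proof (rule C_lim)
    show "(\<lambda>x. c * indicator (E \<inter> W n) x) \<in> C" for n
      by (rule C_ind0) fact
    show "(\<lambda>x. c * indicator E x) \<in> borel_measurable M" by measurable
    \<comment> \<open>Continuity from above applies because \<open>E\<close> has finite measure, and
      the \<open>W n\<close> exhaust the space.\<close>
    have "(\<lambda>n. emeasure M (E - W n)) \<longlonglongrightarrow> emeasure M (\<Inter>n. E - W n)"
    proof (rule Lim_emeasure_decseq)
      show "decseq (\<lambda>n. E - W n)" using W(4) by (auto simp: decseq_def incseq_def)
      show "emeasure M (E - W n) \<noteq> \<infinity>" for n
        using emeasure_mono[of "E - W n" E M] that by (auto simp: top_unique)
    qed auto
    moreover have "(\<Inter>n. E - W n) = {}"
      using sets.sets_into_space[OF \<open>E \<in> sets M\<close>] W(2) by auto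
    ultimately have "(\<lambda>n. emeasure M (E - W n)) \<longlonglongrightarrow> 0"
      by (simp only: emeasure_empty)
    then have "(\<lambda>n. ennreal (cmod c powr p) * emeasure M (E - W n)) \<longlonglongrightarrow> ennreal (cmod c powr p) * 0"
      by (intro ennreal_tendsto_cmult) auto
    moreover have "pint M p (\<lambda>x. c * indicator (E \<inter> W n) x - c * indicator E x)
        = ennreal (cmod c powr p) * emeasure M (E - W n)" for n
    proof -
      have "pint M p (\<lambda>x. c * indicator (E \<inter> W n) x - c * indicator E x)
          = pint M p (\<lambda>x. c * indicator (E - W n) x)"
        unfolding pint_def by (intro nn_integral_cong) (auto simp: indicator_def)
      also have "\<dots> = ennreal (cmod c powr p) * emeasure M (E - W n)"
        by (intro pint_indicator) auto
      finally show ?thesis .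
    qed
    ultimately show "(\<lambda>n. pint M p (\<lambda>x. c * indicator (E \<inter> W n) x - c * indicator E x)) \<longlonglongrightarrow> 0"
      by simp
  qed
  have C_sum: "(\<lambda>x. \<Sum>i\<in>I. u i x) \<in> C" if "finite I" "\<And>i. i \<in> I \<Longrightarrow> u i \<in> C" for I and u :: "complex \<Rightarrow> _"
    using that
  proof (induction)
    case empty
    have "(\<lambda>x. 0 * indicator {} x) \<in> C" by (rule C_ind) auto
    then show ?case by simp
  qed (auto intro: C_add)
  have C_simple: "F \<in> C" if F: "simple_function M F" and fin: "pint M p F < \<infinity>" for F
  proof -
    have [measurable]: "F \<in> borel_measurable M" using F by (rule borel_measurable_simple_function)
    define S where "S = (\<lambda>x. \<Sum>y\<in>F ` space M. y * indicator (F -` {y} \<inter> space M) x)"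
    have "S \<in> C"
      unfolding S_def
    proof (rule C_sum)
      show "finite (F ` space M)" using F by (rule simple_functionD)
      fix y
      show "(\<lambda>x. y * indicator (F -` {y} \<inter> space M) x) \<in> C"
      proof (cases "y = 0")
        case True
        then show ?thesis using C_ind[of "{}" 0] by simp
      next
        case False
        \<comment> \<open>Chebyshev at level \<open>cmod y\<close> shows that the fibre over a
          nonzero value has finite measure.\<close>
        have "emeasure M (F -` {y} \<inter> space M) \<le> emeasure M {x\<in>space M. cmod y \<le> cmod (F x)}"
          by (rule emeasure_mono) auto
        also have "\<dots> \<le> ennreal ((1 / cmod y) powr p) * pint M p F"
          using False p by (intro pint_Markov) auto
        also have "\<dots> < \<infinity>" using fin by (auto simp: ennreal_mult_less_top)
        finally show ?thesis by (intro C_ind) auto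
      qed
    qed
    moreover have eq: "S x = F x" if "x \<in> space M" for x
    proof -
      have "S x = (\<Sum>y\<in>F ` space M. if y = F x then y else 0)"
        unfolding S_def using that by (intro sum.cong) (auto simp: indicator_def)
      then show ?thesis
        using that simple_functionD(1)[OF F] by simp
    qed
    moreover have "pint M p (\<lambda>x. d x - S x) = pint M p (\<lambda>x. d x - F x)" for d
      using eq by (intro pint_cong) simp
    ultimately show ?thesis by (simp add: C_def)
  qed
  have all: "h \<in> C" if [measurable]: "h \<in> borel_measurable M" and fin: "pint M p h < \<infinity>" for h
  proof -
    obtain F where "(\<forall>i. simple_function M (F i)) \<and> (\<forall>x\<in>space M. (\<lambda>i. F i x) \<longlonglongrightarrow> h x) \<and>
        (\<forall>i. \<forall>x\<in>space M. dist (F i x) 0 \<le> 2 * dist (h x) 0)"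
      by (rule exE[OF borel_measurable_implies_sequence_metric[OF \<open>h \<in> borel_measurable M\<close>, of 0]])
    then have F: "\<And>i. simple_function M (F i)" "\<And>x. x \<in> space M \<Longrightarrow> (\<lambda>i. F i x) \<longlonglongrightarrow> h x"
      "\<And>i x. x \<in> space M \<Longrightarrow> cmod (F i x) \<le> 2 * cmod (h x)"
      by simp_all
    have [measurable]: "F i \<in> borel_measurable M" for i
      using F(1) by (rule borel_measurable_simple_function)
    have le: "cmod (F i x) powr p \<le> 2 powr p * cmod (h x) powr p" if "x \<in> space M" for i x
    proof -
      have "cmod (F i x) powr p \<le> (2 * cmod (h x)) powr p"
        using p F(3)[OF that] by (intro powr_mono2) auto
      then show ?thesis by (simp add: powr_mult)
    qed
    have "pint M p (F i) \<le> pint M p (\<lambda>x. 2 * h x)" for i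
      unfolding pint_def using le by (intro nn_integral_mono) (simp add: norm_mult powr_mult ennreal_leI)
    also have "\<dots> < \<infinity>" using fin by (simp add: pint_mult ennreal_mult_less_top)
    finally have "pint M p (F i) < \<infinity>" for i .
    then have FC: "F i \<in> C" for i by (intro C_simple F(1))
    \<comment> \<open>Dominated convergence: the approximants satisfy
      \<open>cmod (F i x) \<le> 2 * cmod (h x)\<close>, so the differences are dominated by
      \<open>3 * h\<close>.\<close>
    have "(\<lambda>i. pint M p (\<lambda>x. F i x - h x)) \<longlonglongrightarrow> 0"
    proof -
      have "(\<lambda>i. \<integral>\<^sup>+x. ennreal (cmod (F i x - h x) powr p) \<partial>M) \<longlonglongrightarrow> (\<integral>\<^sup>+x. 0 \<partial>M)"
      proof (rule nn_integral_dominated_convergence[where w="\<lambda>x. ennreal (cmod (3 * h x) powr p)"])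
        have "(\<integral>\<^sup>+x. ennreal (cmod (3 * h x) powr p) \<partial>M) = pint M p (\<lambda>x. 3 * h x)"
          by (simp add: pint_def)
        also have "\<dots> < \<infinity>" using fin by (simp add: pint_mult ennreal_mult_less_top)
        finally show "(\<integral>\<^sup>+x. ennreal (cmod (3 * h x) powr p) \<partial>M) < \<infinity>" .
        show "AE x in M. ennreal (cmod (F j x - h x) powr p) \<le> ennreal (cmod (3 * h x) powr p)" for j
        proof (rule AE_I2)
          fix x assume "x \<in> space M"
          then have "cmod (F j x - h x) \<le> cmod (3 * h x)"
            using F(3)[of x j] norm_triangle_ineq4[of "F j x" "h x"] by (simp add: norm_mult)
          then show "ennreal (cmod (F j x - h x) powr p) \<le> ennreal (cmod (3 * h x) powr p)"
            using p by (intro ennreal_leI powr_mono2) auto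
        qed
        show "AE x in M. (\<lambda>i. ennreal (cmod (F i x - h x) powr p)) \<longlonglongrightarrow> 0"
        proof (rule AE_I2)
          fix x assume "x \<in> space M"
          then have "(\<lambda>i. cmod (F i x - h x)) \<longlonglongrightarrow> 0"
            using F(2)[of x] by (simp add: tendsto_norm_zero LIM_zero)
          then have "(\<lambda>i. cmod (F i x - h x) powr p) \<longlonglongrightarrow> 0 powr p"
            by (rule tendsto_powr') (use p in auto)
          then show "(\<lambda>i. ennreal (cmod (F i x - h x) powr p)) \<longlonglongrightarrow> 0"
            using tendsto_ennrealI[of "\<lambda>i. cmod (F i x - h x) powr p" 0] by simp
        qed
      qed auto
      then show ?thesis by (simp add: pint_def)
    qed
    then show ?thesis by (intro C_lim[OF \<open>h \<in> borel_measurable M\<close> FC])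
  qed
  show ?thesis
  proof (rule that[of D])
    show "countable D" using D1 by (simp add: D_def)
    show "D \<noteq> {}" using D0D by auto
    show "D \<subseteq> borel_measurable M" using Dm by auto
    show "bounded (range d)" "emeasure M {x\<in>space M. d x \<noteq> 0} < \<infinity>" if "d \<in> D" for d
      using that by (auto simp: D_def G_def)
    fix h and \<epsilon> :: ennreal assume "h \<in> borel_measurable M" "pint M p h < \<infinity>" "0 < \<epsilon>"
    then have "h \<in> C" using all by blast
    obtain e :: real where "0 < e" "ennreal e \<le> \<epsilon>"
      by (rule ennreal_pos_imp_real_le[OF \<open>0 < \<epsilon>\<close>])
    moreover from this have "\<exists>d\<in>D. pint M p (\<lambda>x. d x - h x) < ennreal e"
      using \<open>h \<in> C\<close> by (simp add: C_def)
    ultimately show "\<exists>d\<in>D. pint M p (\<lambda>x. d x - h x) < \<epsilon>"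
      using less_le_trans by blast
  qed
qed

subsection \<open>Dense translates\<close>

text \<open>Open below and closed above, so that bands are disjoint as soon as the upper end of one
  is at most the lower end of the other.\<close>

definition band :: "('a \<Rightarrow> complex) \<Rightarrow> real \<Rightarrow> real \<Rightarrow> 'a set" where
  "band f a b = {t. a < cmod (f t) \<and> cmod (f t) \<le> b}"

lemma measurable_translation:
  fixes s :: "'a :: topological_group_add"
  assumes "sets M = sets borel"
  shows "(\<lambda>t. s + t) \<in> M \<rightarrow>\<^sub>M borel"
proof -
  have "(\<lambda>t. s + t) \<in> borel_measurable borel"
    by (intro borel_measurable_continuous_onI continuous_intros)
  then show ?thesis
    using assms measurable_cong_sets by blast
qed

lemma approximate_by_multiple_translate:
  fixes M :: "'a :: topological_group_add measure"
  assumes sM: "sets M = sets borel" and fm: "f \<in> borel_measurable borel" and p: "1 \<le> p"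
    and dense: "\<And>h \<epsilon>. h \<in> borel_measurable borel \<Longrightarrow> pint M p h < \<infinity> \<Longrightarrow> 0 < \<epsilon> \<Longrightarrow>
      \<exists>c\<in>\<Gamma>. \<exists>s\<in>S. pint M p (\<lambda>t. c * f (- s + t) - h t) < \<epsilon>"
    and \<Gamma>: "\<And>z. z \<in> \<Gamma> - {0} \<Longrightarrow> \<delta> \<le> cmod z \<and> cmod z \<le> C" and "0 < \<delta>" "0 < C"
    and F: "F \<in> sets borel" "0 < emeasure M F" "emeasure M F < \<infinity>"
    and "0 < \<epsilon>" "1 \<le> a"
  obtains s b where "s \<in> S" "a \<le> b"
    "emeasure M {t\<in>F. - s + t \<notin> band f a b} \<le> \<epsilon>"
    "emeasure M {t. 1 \<le> cmod (f (- s + t)) \<and> cmod (f (- s + t)) \<le> a} \<le> \<epsilon>"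
proof -
  have spM: "space M = UNIV"
    using sM sets_eq_imp_space_eq by fastforce
  note [measurable_cong] = sM
  note [measurable] = fm F(1)
  txt \<open>
    If \<open>c\<close> times the translate of \<open>f\<close> is close to \<open>R\<close> on \<open>F\<close> and to \<open>0\<close> off \<open>F\<close>, then the modulus
    of the translate exceeds \<open>a\<close> on most of \<open>F\<close>, while values in \<open>[1, a]\<close> are far from both
    targets because \<open>\<delta> \<le> \<bar>c\<bar> \<le> C\<close>.
  \<close>
  define R where "R = C * a + 1"
  have R: "R > 1" using \<open>0 < C\<close> \<open>1 \<le> a\<close> by (simp add: R_def)
  \<comment> \<open>On \<open>F\<close>, off the exceptional set, \<open>c\<close> times the
    translate has modulus at most \<open>R + 1\<close>, and dividing by
    \<open>\<delta> \<le> cmod c\<close> bounds the translate itself. The maximum ensures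
    \<open>a \<le> b\<close>.\<close>
  define b where "b = max a ((R + 1) / \<delta>)"
  \<comment> \<open>On \<open>F\<close> the errors to be detected are at least 1, the surplus of
    \<open>R\<close> over \<open>C * a\<close>; off \<open>F\<close> they are at least
    \<open>\<delta>\<close>. The minimum serves both cases.\<close>
  define d where "d = min 1 \<delta>"
  have d: "0 < d" "d \<le> 1" "d \<le> \<delta>" using \<open>0 < \<delta>\<close> by (auto simp: d_def)
  define h :: "'a \<Rightarrow> complex" where "h = (\<lambda>t. of_real R * indicator F t)"
  have hm[measurable]: "h \<in> borel_measurable borel"
    unfolding h_def by measurable
  have hI: "pint M p h = ennreal (R powr p) * emeasure M F"
    unfolding h_def using R F(1) by (subst pint_indicator) (auto simp: sM)
  \<comment> \<open>The first term makes the exceptional set \<open>E\<close> small by Chebyshev.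
    The second excludes \<open>c = 0\<close>, which \<open>\<Gamma>\<close> may contain: for it the
    error would be exactly \<open>pint M p h\<close>, positive because \<open>F\<close> is not
    null.\<close>
  define \<eta> where "\<eta> = min (ennreal (d powr p) * \<epsilon>) (pint M p h)"
  have hI0: "pint M p h > 0"
    using F R by (simp add: hI ennreal_zero_less_mult_iff)
  have "ennreal (d powr p) * \<epsilon> > 0"
    using \<open>0 < \<epsilon>\<close> d by (simp add: ennreal_zero_less_mult_iff)
  then have "\<eta> > 0" using hI0 by (simp add: \<eta>_def)
  moreover have "pint M p h < \<infinity>"
    using F by (simp add: hI ennreal_mult_less_top)
  ultimately obtain c s where cs: "c \<in> \<Gamma>" "s \<in> S" "pint M p (\<lambda>t. c * f (- s + t) - h t) < \<eta>"
    using dense[OF hm] by blast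
  have "c \<noteq> 0"
  proof
    assume "c = 0"
    then have "pint M p h < \<eta>" using cs(3) by (simp add: pint_uminus)
    then show False by (simp add: \<eta>_def)
  qed
  then have c: "\<delta> \<le> cmod c" "cmod c \<le> C" using \<Gamma> cs(1) by auto
  note [measurable] = measurable_translation[OF sM, of "- s"] measurable_translation[OF refl, of "- s"]
  define E where "E = {t. d \<le> cmod (c * f (- s + t) - h t)}"
  have Em: "E \<in> sets M"
    unfolding E_def sM by measurable
  have "emeasure M E \<le> ennreal ((1 / d) powr p) * pint M p (\<lambda>t. c * f (- s + t) - h t)"
    using pint_Markov[of "\<lambda>t. c * f (- s + t) - h t" M d p] d p
    by (simp add: E_def spM)
  also have "\<dots> \<le> ennreal ((1 / d) powr p) * (ennreal (d powr p) * \<epsilon>)"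
    using cs(3) by (intro mult_left_mono) (auto simp: \<eta>_def)
  also have "\<dots> = ennreal ((1 / d) powr p * d powr p) * \<epsilon>"
    by (simp add: ennreal_mult mult.assoc)
  also have "\<dots> = \<epsilon>"
    using d by (simp flip: powr_mult)
  finally have E: "emeasure M E \<le> \<epsilon>" .
  have "{t\<in>F. - s + t \<notin> band f a b} \<subseteq> E"
  proof safe
    fix t assume "t \<in> F" "- s + t \<notin> band f a b"
    show "t \<in> E"
    proof (rule ccontr)
      assume "t \<notin> E"
      then have 1: "cmod (c * f (- s + t) - of_real R) < 1"
        using \<open>t \<in> F\<close> d by (auto simp: E_def h_def)
      have "R \<le> cmod (c * f (- s + t)) + cmod (c * f (- s + t) - of_real R)"
        using norm_triangle_ineq4[of "c * f (- s + t)" "c * f (- s + t) - of_real R"] R by simp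
      then have "C * a < cmod c * cmod (f (- s + t))"
        using 1 by (simp add: R_def norm_mult)
      also have "\<dots> \<le> C * cmod (f (- s + t))"
        using c by (intro mult_right_mono) auto
      finally have "a < cmod (f (- s + t))" using \<open>0 < C\<close> by simp
      moreover have "cmod (f (- s + t)) \<le> b"
      proof -
        have "\<delta> * cmod (f (- s + t)) \<le> cmod (c * f (- s + t))"
          using c by (simp add: norm_mult mult_right_mono)
        also have "\<dots> \<le> R + 1"
          using 1 norm_triangle_ineq[of "c * f (- s + t) - of_real R" "of_real R"] R by simp
        finally have "cmod (f (- s + t)) \<le> (R + 1) / \<delta>"
          using \<open>0 < \<delta>\<close> by (simp add: field_simps)
        then show ?thesis by (simp add: b_def)
      qed
      ultimately show False using \<open>- s + t \<notin> band f a b\<close> by (simp add: band_def)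
    qed
  qed
  moreover have "{t. 1 \<le> cmod (f (- s + t)) \<and> cmod (f (- s + t)) \<le> a} \<subseteq> E"
  proof safe
    fix t assume t: "1 \<le> cmod (f (- s + t))" "cmod (f (- s + t)) \<le> a"
    show "t \<in> E"
    proof (cases "t \<in> F")
      case True
      have "cmod (c * f (- s + t)) \<le> C * a"
        unfolding norm_mult using c t \<open>0 < C\<close> by (intro mult_mono) auto
      moreover have "R \<le> cmod (c * f (- s + t)) + cmod (c * f (- s + t) - of_real R)"
        using norm_triangle_ineq4[of "c * f (- s + t)" "c * f (- s + t) - of_real R"] R by simp
      ultimately have "1 \<le> cmod (c * f (- s + t) - of_real R)"
        by (simp add: R_def)
      then show ?thesis using d True by (simp add: E_def h_def)
    next
      case False
      have "\<delta> * 1 \<le> cmod c * cmod (f (- s + t))"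
        using c t \<open>0 < \<delta>\<close> by (intro mult_mono) auto
      then show ?thesis using d False by (simp add: E_def h_def norm_mult)
    qed
  qed
  moreover have "a \<le> b" by (simp add: b_def)
  ultimately show ?thesis
    using that[OF cs(2), of b] order_trans[OF emeasure_mono[OF _ Em] E] by blast
qed

text \<open>Chebyshev bounds the superlevel set by \<open>i * (1/a) powr p\<close>, which is at most
  \<open>i / a\<close> for \<open>1 \<le> a\<close> and \<open>1 \<le> p\<close>; hence any
  \<open>a\<close> above \<open>K * i / \<epsilon>\<close> works. The lower bound \<open>b\<close>
  lets a new band start above the previous one.\<close>

lemma emeasure_superlevel_small:
  assumes [measurable]: "f \<in> borel_measurable M" and fin: "pint M p f < \<infinity>" and "1 \<le> p"
    and "0 \<le> K" "0 < \<epsilon>"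
  obtains a where "b \<le> a" "1 \<le> a" "ennreal K * emeasure M {t\<in>space M. a < cmod (f t)} \<le> ennreal \<epsilon>"
proof -
  obtain i where i: "pint M p f = ennreal i" "0 \<le> i"
    using fin by (cases "pint M p f") auto
  define a where "a = max (max b 1) (K * i / \<epsilon>)"
  have a: "b \<le> a" "1 \<le> a" "K * i / \<epsilon> \<le> a"
    by (auto simp: a_def)
  have "emeasure M {t\<in>space M. a < cmod (f t)} \<le> emeasure M {t\<in>space M. a \<le> cmod (f t)}"
    by (rule emeasure_mono) auto
  also have "\<dots> \<le> ennreal ((1 / a) powr p) * pint M p f"
    using a \<open>1 \<le> p\<close> by (intro pint_Markov) auto
  also have "\<dots> \<le> ennreal (1 / a) * ennreal i"
  proof -
    have "(1 / a) powr p \<le> (1 / a) powr 1"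
      using a \<open>1 \<le> p\<close> by (intro powr_mono') auto
    then show ?thesis
      using a i by (intro mult_mono) (auto intro: ennreal_leI)
  qed
  finally have "ennreal K * emeasure M {t\<in>space M. a < cmod (f t)}
      \<le> ennreal K * (ennreal (1 / a) * ennreal i)"
    by (rule mult_left_mono) auto
  also have "\<dots> = ennreal (K * i / a)"
    using a \<open>0 \<le> K\<close> i by (simp flip: ennreal_mult)
  also have "\<dots> \<le> ennreal \<epsilon>"
    using a \<open>0 < \<epsilon>\<close> by (intro ennreal_leI) (simp add: field_simps)
  finally show ?thesis using a that by blast
qed

text \<open>The core of the hard direction, free of weights and Haar measure: only translations by
  elements of \<open>S\<close> have to be bounded, each with its own factor \<open>c s\<close>. No
  uniformity in \<open>s\<close> is required, because the levels of later bands are chosen once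
  \<open>s\<close> is known.\<close>

lemma exists_dense_translates:
  fixes M :: "'a :: {topological_group_add, second_countable_topology} measure"
  assumes sM: "sets M = sets borel" and sf: "sigma_finite_measure M" and nz: "emeasure M UNIV \<noteq> 0"
    and p: "1 \<le> p"
    and fm: "f \<in> borel_measurable borel" and ffin: "pint M p f < \<infinity>"
    and dense: "\<And>h \<epsilon>. h \<in> borel_measurable borel \<Longrightarrow> pint M p h < \<infinity> \<Longrightarrow> 0 < \<epsilon> \<Longrightarrow>
      \<exists>c\<in>\<Gamma>. \<exists>s\<in>S. pint M p (\<lambda>t. c * f (- s + t) - h t) < \<epsilon>"
    and \<Gamma>: "\<And>z. z \<in> \<Gamma> - {0} \<Longrightarrow> \<delta> \<le> cmod z \<and> cmod z \<le> C" and "0 < \<delta>" "0 < C"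
    and quasi: "\<And>s u. s \<in> S \<Longrightarrow> u \<in> borel_measurable borel \<Longrightarrow>
      (\<integral>\<^sup>+t. u (- s + t) \<partial>M) \<le> ennreal (c s) * (\<integral>\<^sup>+t. u t \<partial>M)"
  shows "\<exists>g\<in>borel_measurable borel. pint M p g < \<infinity> \<and>
    (\<forall>h\<in>borel_measurable borel. pint M p h < \<infinity> \<longrightarrow>
      (\<forall>\<epsilon>>0. \<exists>s\<in>S. pint M p (\<lambda>t. g (- s + t) - h t) < ennreal \<epsilon>))"
proof -
  interpret sigma_finite_measure M by fact
  have spM: "space M = UNIV"
    using sM sets_eq_imp_space_eq by fastforce
  note [measurable_cong] = sM
  note [measurable] = fm

  \<comment> \<open>A recurring dense sequence and the sets to be covered\<close>
  obtain W :: "nat \<Rightarrow> 'a set" where W: "range W \<subseteq> sets M" "(\<Union>i. W i) = space M"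
    "\<And>i. emeasure M (W i) \<noteq> \<infinity>"
    using sigma_finite by blast
  have "\<exists>i. emeasure M (W i) \<noteq> 0"
  proof (rule ccontr)
    assume "\<nexists>i. emeasure M (W i) \<noteq> 0"
    then have "emeasure M (\<Union>i. W i) = 0"
      using W(1) by (intro emeasure_UN_eq_0) auto
    then show False using nz W(2) spM by simp
  qed
  then obtain W0 where W0: "W0 \<in> sets borel" "0 < emeasure M W0" "emeasure M W0 < \<infinity>"
    using W sM by (metis infinity_ennreal_def not_gr_zero rangeI subsetD top.not_eq_extremum)

  obtain B :: "'a set set" where B: "countable B" "topological_basis B"
    using ex_countable_basis by blast
  have "sets M = sigma_sets (space M) B"
    using sets_measure_of[of B UNIV] borel_eq_countable_basis[OF B] sM spM by (metis subset_UNIV Pow_UNIV)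
  then obtain D where D: "countable D" "D \<noteq> {}" "D \<subseteq> borel_measurable M"
    "\<And>d. d \<in> D \<Longrightarrow> bounded (range d)"
    "\<And>d. d \<in> D \<Longrightarrow> emeasure M {x\<in>space M. d x \<noteq> 0} < \<infinity>"
    "\<And>h \<epsilon>. h \<in> borel_measurable M \<Longrightarrow> pint M p h < \<infinity> \<Longrightarrow> 0 < \<epsilon> \<Longrightarrow>
        \<exists>d\<in>D. pint M p (\<lambda>x. d x - h x) < \<epsilon>"
    using countable_dense_pint[OF sf B(1) _ p] by blast
  \<comment> \<open>The second component of the decoded pair enumerates \<open>D\<close>; the first
    is ignored, so every element of \<open>D\<close> occurs at arbitrarily large indices.\<close>
  define \<phi> where "\<phi> = (\<lambda>n. from_nat_into D (snd (prod_decode n)))"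
  have \<phi>D: "\<phi> n \<in> D" for n
    using D(2) by (simp add: \<phi>_def from_nat_into)
  have \<phi>io: "\<exists>n\<ge>N. \<phi> n = d" if "d \<in> D" for d N
  proof (intro exI conjI)
    show "N \<le> prod_encode (N, to_nat_on D d)" by (rule le_prod_encode_1)
    show "\<phi> (prod_encode (N, to_nat_on D d)) = d"
      using that D(1) by (simp add: \<phi>_def)
  qed
  have \<phi>m[measurable]: "\<phi> n \<in> borel_measurable borel" for n
  proof -
    have "\<phi> n \<in> borel_measurable M" using \<phi>D D(3) by blast
    then show ?thesis using sM measurable_cong_sets by blast
  qed
  have "\<exists>b. \<forall>t. cmod (\<phi> n t) \<le> b" for n
    using D(4)[OF \<phi>D[of n]] by (auto simp: bounded_iff)
  then obtain m0 where m0: "\<And>n t. cmod (\<phi> n t) \<le> m0 n" by metis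
  \<comment> \<open>Partial sums make the bounds increasing in \<open>n\<close>, so that
    \<open>m k\<close> also dominates every earlier function.\<close>
  define m where "m = (\<lambda>n. 1 + (\<Sum>i\<le>n. \<bar>m0 i\<bar>))"
  have m1: "1 \<le> m n" for n by (simp add: m_def sum_nonneg)
  have mmono: "m i \<le> m j" if "i \<le> j" for i j
    unfolding m_def using that by (intro add_left_mono sum_mono2) auto
  have m\<phi>: "cmod (\<phi> n t) \<le> m n" for n t
  proof -
    have "\<bar>m0 n\<bar> \<le> (\<Sum>i\<le>n. \<bar>m0 i\<bar>)" by (rule member_le_sum) auto
    then show ?thesis using m0[of n t] by (simp add: m_def)
  qed
  \<comment> \<open>Joining \<open>W0\<close> gives \<open>F n\<close> positive measure even if
    \<open>\<phi> n\<close> vanishes almost everywhere, as the approximation step demands.\<close>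
  define F where "F = (\<lambda>n. {t. \<phi> n t \<noteq> 0} \<union> W0)"
  have Fm[measurable]: "F n \<in> sets borel" for n
    unfolding F_def using W0(1) by measurable
  have Ffin: "emeasure M (F n) < \<infinity>" for n
  proof -
    have "emeasure M (F n) \<le> emeasure M {t. \<phi> n t \<noteq> 0} + emeasure M W0"
      unfolding F_def using W0(1) by (intro emeasure_subadditive) (auto simp: sM)
    also have "\<dots> < \<infinity>"
      using D(5)[OF \<phi>D[of n]] W0 by (simp add: spM)
    finally show ?thesis .
  qed
  have Fpos: "0 < emeasure M (F n)" for n
  proof -
    have "emeasure M W0 \<le> emeasure M (F n)"
      by (rule emeasure_mono) (simp_all add: F_def sM Fm[unfolded F_def])
    with W0(2) show ?thesis by (rule less_le_trans)
  qed

  \<comment> \<open>Recursive choice of translates and bands\<close>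
  define K where "K = (\<lambda>n. (2 * m n) powr p)"
  have K1: "1 \<le> K n" for n
    unfolding K_def using m1[of n] p by (intro ge_one_powr_ge_zero) auto
  \<comment> \<open>\<open>K n\<close> bounds the p-th power of the difference of two values of
    modulus at most \<open>m n\<close>, so an exceptional set of measure \<open>e n\<close>
    contributes at most \<open>(1/2) ^ n\<close>.\<close>
  define e where "e = (\<lambda>n. (1/2) ^ n / K n)"
  have e: "0 < e n" for n using K1[of n] by (simp add: e_def)
  define P where "P = (\<lambda>n (s, a, b, q). s \<in> S \<and> 1 \<le> a \<and> a \<le> b \<and> 1 \<le> q \<and> c s \<le> q \<and>
    emeasure M {t\<in>F n. - s + t \<notin> band f a b} \<le> e n \<and>
    emeasure M {t. 1 \<le> cmod (f (- s + t)) \<and> cmod (f (- s + t)) \<le> a} \<le> e n)"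
  txt \<open>The number \<open>q\<close> bounds the translation constants of all steps so far.\<close>
  define Q where "Q = (\<lambda>n (s :: 'a, a :: real, b, q) (s' :: 'a, a', b' :: real, q'). b \<le> a' \<and> q \<le> q' \<and>
    ennreal (q * K (Suc n)) * emeasure M {t. a' < cmod (f t)} \<le> ennreal ((1/2) ^ Suc n))"
  have next_step: "\<exists>s b q'. P n (s, a, b, q') \<and> q \<le> q'" if "1 \<le> a" for n a q
  proof -
    obtain s b where "s \<in> S" "a \<le> b"
      "emeasure M {t\<in>F n. - s + t \<notin> band f a b} \<le> e n"
      "emeasure M {t. 1 \<le> cmod (f (- s + t)) \<and> cmod (f (- s + t)) \<le> a} \<le> e n"
      by (rule approximate_by_multiple_translate[OF sM fm p dense \<Gamma> \<open>0 < \<delta>\<close> \<open>0 < C\<close>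
          Fm Fpos Ffin _ \<open>1 \<le> a\<close>, where \<epsilon>="ennreal (e n)"]) (use e in auto)
    then have "P n (s, a, b, max q (max 1 (c s)))"
      using \<open>1 \<le> a\<close> by (simp add: P_def le_max_iff_disj)
    then show ?thesis
      using max.cobounded1 by blast
  qed
  have "\<exists>X. \<forall>n. P n (X n) \<and> Q n (X n) (X (Suc n))"
  proof (rule dependent_nat_choice)
    show "\<exists>x. P 0 x" using next_step[of 1 0] by blast
    fix x n assume "P n x"
    obtain s a b q where x: "x = (s, a, b, q)" by (cases x)
    have "0 \<le> q * K (Suc n)" using \<open>P n x\<close> K1[of "Suc n"] by (simp add: P_def x)
    have "f \<in> borel_measurable M" by measurable
    \<comment> \<open>The lower level of the next band is chosen only now, when \<open>q\<close>
      dominates the constants of all translations chosen so far; the decay of the superlevel sets of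
      \<open>f\<close> pays for \<open>q\<close> and for \<open>K (Suc n)\<close>.\<close>
    obtain a' where a': "b \<le> a'" "1 \<le> a'"
      "ennreal (q * K (Suc n)) * emeasure M {t\<in>space M. a' < cmod (f t)} \<le> ennreal ((1/2) ^ Suc n)"
      by (rule emeasure_superlevel_small[OF \<open>f \<in> borel_measurable M\<close> ffin p \<open>0 \<le> q * K (Suc n)\<close>,
          of "(1/2) ^ Suc n" b]) simp
    obtain s' b' q' where "P (Suc n) (s', a', b', q')" "q \<le> q'"
      using next_step[OF a'(2)] by blast
    then show "\<exists>y. P (Suc n) y \<and> Q n x y"
      using a' by (intro exI[of _ "(s', a', b', q')"]) (simp add: Q_def x spM)
  qed
  then obtain X where X: "\<And>n. P n (X n)" "\<And>n. Q n (X n) (X (Suc n))" by blast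
  define s where "s = (\<lambda>n. fst (X n))"
  define a where "a = (\<lambda>n. fst (snd (X n)))"
  define b where "b = (\<lambda>n. fst (snd (snd (X n))))"
  define q where "q = (\<lambda>n. snd (snd (snd (X n))))"
  have Xeq: "X n = (s n, a n, b n, q n)" for n
    by (simp add: s_def a_def b_def q_def)
  have sS: "s n \<in> S" and a1: "1 \<le> a n" and ab: "a n \<le> b n" and q1: "1 \<le> q n" and cq: "c (s n) \<le> q n"
    and bad1: "emeasure M {t\<in>F n. - s n + t \<notin> band f (a n) (b n)} \<le> e n"
    and bad2: "emeasure M {t. 1 \<le> cmod (f (- s n + t)) \<and> cmod (f (- s n + t)) \<le> a n} \<le> e n" for n
    using X(1)[of n] by (auto simp: P_def Xeq)
  have ba: "b n \<le> a (Suc n)" and qSuc: "q n \<le> q (Suc n)"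
    and tail: "ennreal (q n * K (Suc n)) * emeasure M {t. a (Suc n) < cmod (f t)} \<le> ennreal ((1/2) ^ Suc n)" for n
    using X(2)[of n] by (auto simp: Q_def Xeq)
  have bmono: "b i \<le> b j" if "i \<le> j" for i j
    using lift_Suc_mono_le[of b, OF _ that] ba ab order_trans by blast
  have qmono: "q i \<le> q j" if "i \<le> j" for i j
    using lift_Suc_mono_le[of q, OF _ that] qSuc by blast
  have ba': "b i \<le> a j" if "i < j" for i j
  proof -
    have "b i \<le> b (j - 1)" using that by (intro bmono) auto
    also have "\<dots> \<le> a j" using ba[of "j - 1"] that by simp
    finally show ?thesis .
  qed
  define A where "A = (\<lambda>n. band f (a n) (b n))"
  have Am[measurable]: "A n \<in> sets borel" for n
    unfolding A_def band_def by measurable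
  have disj: "i = j" if "t \<in> A i" "t \<in> A j" for i j t
    using that ba'[of i j] ba'[of j i] by (force simp: A_def band_def not_less_iff_gr_or_eq)
  \<comment> \<open>The estimate recorded when band \<open>n\<close> was opened involves
    \<open>q (n - 1)\<close>; as \<open>q\<close> increases, it serves every earlier
    translate.\<close>
  have tail': "ennreal (q k * K n) * emeasure M (A n) \<le> ennreal ((1/2) ^ n)" if "k < n" for k n
  proof -
    obtain j where n: "n = Suc j" "k \<le> j" using \<open>k < n\<close> by (cases n) auto
    have "ennreal (q k * K n) * emeasure M (A n) \<le> ennreal (q j * K n) * emeasure M {t. a n < cmod (f t)}"
      using qmono[OF n(2)] K1[of n] q1[of j]
      by (intro mult_mono ennreal_leI emeasure_mono mult_right_mono) (auto simp: A_def band_def sM)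
    also have "\<dots> \<le> ennreal ((1/2) ^ n)" using tail[of j] n by simp
    finally show ?thesis .
  qed

  \<comment> \<open>The candidate vector and its integrability\<close>
  define g where "g = (\<lambda>t. \<Sum>n. indicator (A n) t * \<phi> n (s n + t))"
  note [measurable] = measurable_translation[OF refl] measurable_translation[OF sM]
  have gm[measurable]: "g \<in> borel_measurable borel"
    unfolding g_def by measurable
  \<comment> \<open>The bands are disjoint, so on \<open>A n\<close> only the summand with index
    \<open>n\<close> survives.\<close>
  have gA: "g t = \<phi> n (s n + t)" if "t \<in> A n" for t n
  proof -
    have "g t = (\<Sum>k. if k = n then \<phi> n (s n + t) else 0)"
      unfolding g_def using that disj by (intro suminf_cong) (auto simp: indicator_def)
    also have "\<dots> = \<phi> n (s n + t)"
      using sums_single[of n "\<lambda>_. \<phi> n (s n + t)"] by (simp add: sums_unique[symmetric])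
    finally show ?thesis .
  qed
  have g0: "g t = 0" if "\<And>n. t \<notin> A n" for t
    unfolding g_def using that by simp
  have term_le: "u n \<le> (\<Sum>i. u i)" for u :: "nat \<Rightarrow> ennreal" and n
    using sum_le_suminf[of u "{n}"] by simp
  have half: "(\<Sum>n. ennreal ((1/2) ^ (Suc k + n))) = ennreal ((1/2) ^ k)" for k
  proof (rule suminf_ennreal_eq)
    have "(\<lambda>n. (1/2::real) ^ k * (1/2) ^ Suc n) sums ((1/2) ^ k * 1)"
      by (intro sums_mult power_half_series)
    then show "(\<lambda>n. (1/2::real) ^ (Suc k + n)) sums (1/2) ^ k"
      by (simp add: power_add)
  qed auto

  have gfin: "pint M p g < \<infinity>"
  proof -
    have "ennreal (cmod (g t) powr p) \<le> (\<Sum>n. ennreal (K n) * indicator (A n) t)" for t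
    proof (cases "\<exists>n. t \<in> A n")
      case True
      then obtain n where n: "t \<in> A n" by blast
      have "cmod (g t) powr p \<le> K n"
        unfolding K_def using m\<phi>[of n "s n + t"] m1[of n] p gA[OF n] by (intro powr_mono2) auto
      then have "ennreal (cmod (g t) powr p) \<le> ennreal (K n) * indicator (A n) t"
        using n by (simp add: ennreal_leI)
      then show ?thesis using term_le[of "\<lambda>n. ennreal (K n) * indicator (A n) t" n] by (rule order_trans)
    next
      case False
      then show ?thesis using g0 by simp
    qed
    then have "pint M p g \<le> (\<integral>\<^sup>+t. (\<Sum>n. ennreal (K n) * indicator (A n) t) \<partial>M)"
      unfolding pint_def by (intro nn_integral_mono)
    also have "\<dots> = (\<Sum>n. ennreal (K n) * emeasure M (A n))"
      by (subst nn_integral_suminf) (auto simp: nn_integral_cmult sM)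
    \<comment> \<open>Band 0 is split off because the tail estimates start at index 1; its measure
      is finite since \<open>1 \<le> a 0\<close> and \<open>f\<close> has finite integral.\<close>
    also have "\<dots> = ennreal (K 0) * emeasure M (A 0) + (\<Sum>n. ennreal (K (Suc n)) * emeasure M (A (Suc n)))"
      by (subst suminf_offset[of _ 1]) (auto simp: add.commute)
    also have "\<dots> \<le> ennreal (K 0) * emeasure M (A 0) + (\<Sum>n. ennreal ((1/2) ^ (Suc 0 + n)))"
    proof (intro add_left_mono suminf_le)
      fix n
      have "ennreal (K (Suc n)) * emeasure M (A (Suc n)) \<le> ennreal (q 0 * K (Suc n)) * emeasure M (A (Suc n))"
        using q1[of 0] K1[of "Suc n"] by (intro mult_right_mono ennreal_leI) auto
      also have "\<dots> \<le> ennreal ((1/2) ^ Suc n)" by (rule tail') simp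
      finally show "ennreal (K (Suc n)) * emeasure M (A (Suc n)) \<le> ennreal ((1/2) ^ (Suc 0 + n))" by simp
    qed auto
    also have "\<dots> < \<infinity>"
    proof -
      have "emeasure M (A 0) \<le> emeasure M {t\<in>space M. 1 \<le> cmod (f t)}"
        using a1[of 0] by (intro emeasure_mono) (auto simp: A_def band_def spM sM)
      also have "\<dots> \<le> ennreal ((1 / 1) powr p) * pint M p f"
        using p by (intro pint_Markov) auto
      also have "\<dots> < \<infinity>" using ffin by simp
      finally show ?thesis unfolding half by (simp add: ennreal_mult_less_top)
    qed
    finally show ?thesis .
  qed

  \<comment> \<open>Distance from a translate of \<open>g\<close> to its target\<close>
  have close: "pint M p (\<lambda>t. g (- s k + t) - \<phi> k t) \<le> ennreal (3 * (1/2) ^ k)" for k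
  proof -
    define B1 where "B1 = {t\<in>F k. - s k + t \<notin> A k}"
    define B2 where "B2 = {t. 1 \<le> cmod (f (- s k + t)) \<and> cmod (f (- s k + t)) \<le> a k}"
    have [measurable]: "B1 \<in> sets borel" "B2 \<in> sets borel"
      unfolding B1_def B2_def by measurable
    let ?T = "\<lambda>n t. ennreal (K (Suc k + n)) * indicator (A (Suc k + n)) (- s k + t)"
    \<comment> \<open>Split by the band that contains \<open>- s k + t\<close>. If there is none,
      \<open>g\<close> is 0 there and the error lives on \<open>F k\<close>, hence on
      \<open>B1\<close>. In band \<open>k\<close> the two functions agree. An earlier band lies
      between the levels \<open>1\<close> and \<open>a k\<close>, hence gives \<open>B2\<close>. A
      later band \<open>n\<close> gives the term of index \<open>n - Suc k\<close> in the
      series.\<close>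
    have bound: "ennreal (cmod (g (- s k + t) - \<phi> k t) powr p) \<le>
        ennreal (K k) * indicator B1 t + ennreal (K k) * indicator B2 t + (\<Sum>n. ?T n t)" for t
    proof -
      let ?u = "- s k + t"
      have Kle: "ennreal (cmod (g ?u - \<phi> k t) powr p) \<le> ennreal (K j)"
        if "cmod (g ?u) \<le> m j" "k \<le> j" for j
      proof -
        have "cmod (g ?u - \<phi> k t) \<le> 2 * m j"
          using norm_triangle_ineq4[of "g ?u" "\<phi> k t"] m\<phi>[of k t] mmono[OF \<open>k \<le> j\<close>] that by simp
        then show ?thesis unfolding K_def using p by (intro ennreal_leI powr_mono2) auto
      qed
      consider (none) "\<And>n. ?u \<notin> A n" | (at) "?u \<in> A k" | (before) n where "?u \<in> A n" "n < k"
        | (after) n where "?u \<in> A n" "k < n"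
        by (metis nat_neq_iff)
      then show ?thesis
      proof cases
        case none
        show ?thesis
        proof (cases "t \<in> B1")
          case True
          then show ?thesis
            using Kle[of k] g0[OF none] m1[of k]
            by (intro add_increasing2[OF zero_le add_increasing2[OF zero_le]]) simp
        next
          case False
          then have "\<phi> k t = 0" using none by (auto simp: B1_def F_def)
          then show ?thesis using g0[OF none] by simp
        qed
      next
        case at
        have "g ?u = \<phi> k t" using gA[OF at] by (simp add: add.assoc[symmetric])
        then show ?thesis by simp
      next
        case before
        have "t \<in> B2"
          using before a1[of n] ba'[of n k] by (auto simp: B2_def A_def band_def)
        moreover have "cmod (g ?u) \<le> m k"
          using gA[OF before(1)] m\<phi>[of n "s n + ?u"] mmono[of n k] before(2) by simp
        ultimately show ?thesis
          using Kle[of k] by (intro add_increasing2[OF zero_le add_increasing[OF zero_le]]) simp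
      next
        case after
        have "cmod (g ?u) \<le> m n"
          using gA[OF after(1)] m\<phi>[of n "s n + ?u"] by simp
        then have "ennreal (cmod (g ?u - \<phi> k t) powr p) \<le> ennreal (K n)"
          using after by (intro Kle) auto
        also have "\<dots> = ?T (n - Suc k) t"
          using after by simp
        also have "\<dots> \<le> (\<Sum>n. ?T n t)" by (rule term_le)
        finally show ?thesis by (intro add_increasing) auto
      qed
    qed
    have "pint M p (\<lambda>t. g (- s k + t) - \<phi> k t) \<le>
        (\<integral>\<^sup>+t. ennreal (K k) * indicator B1 t + ennreal (K k) * indicator B2 t + (\<Sum>n. ?T n t) \<partial>M)"
      unfolding pint_def using bound by (intro nn_integral_mono)
    also have "\<dots> = ennreal (K k) * emeasure M B1 + ennreal (K k) * emeasure M B2 + (\<Sum>n. \<integral>\<^sup>+t. ?T n t \<partial>M)"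
      by (simp add: nn_integral_add nn_integral_suminf nn_integral_cmult sM)
    also have "\<dots> \<le> ennreal ((1/2) ^ k) + ennreal ((1/2) ^ k) + (\<Sum>n. ennreal ((1/2) ^ (Suc k + n)))"
    proof (intro add_mono suminf_le)
      have "ennreal (K k) * ennreal (e k) = ennreal ((1/2) ^ k)"
        using K1[of k] by (simp add: e_def flip: ennreal_mult)
      then show "ennreal (K k) * emeasure M B1 \<le> ennreal ((1/2) ^ k)"
          "ennreal (K k) * emeasure M B2 \<le> ennreal ((1/2) ^ k)"
        using mult_left_mono[OF bad1[of k], of "ennreal (K k)"] mult_left_mono[OF bad2[of k], of "ennreal (K k)"]
        by (simp_all add: B1_def B2_def A_def)
      fix n
      \<comment> \<open>Moving a later band by \<open>s k\<close> costs the factor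
        \<open>c (s k) \<le> q k\<close>, which the choice of its lower level has already
        absorbed.\<close>
      have "(\<integral>\<^sup>+t. ?T n t \<partial>M) \<le> ennreal (c (s k)) *
          (\<integral>\<^sup>+t. ennreal (K (Suc k + n)) * indicator (A (Suc k + n)) t \<partial>M)"
        by (rule quasi[OF sS, where u="\<lambda>t. ennreal (K (Suc k + n)) * indicator (A (Suc k + n)) t"]) measurable
      also have "\<dots> \<le> ennreal (q k) * (ennreal (K (Suc k + n)) * emeasure M (A (Suc k + n)))"
        using cq by (intro mult_mono ennreal_leI) (auto simp: nn_integral_cmult sM)
      also have "\<dots> = ennreal (q k * K (Suc k + n)) * emeasure M (A (Suc k + n))"
        using q1[of k] K1[of "Suc k + n"] by (simp add: ennreal_mult' mult.assoc)
      also have "\<dots> \<le> ennreal ((1/2) ^ (Suc k + n))"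
        by (rule tail') simp
      finally show "(\<integral>\<^sup>+t. ?T n t \<partial>M) \<le> ennreal ((1/2) ^ (Suc k + n))" .
    qed auto
    also have "\<dots> = ennreal (3 * (1/2) ^ k)"
      unfolding half by (simp flip: ennreal_plus)
    finally show ?thesis .
  qed

  \<comment> \<open>Density of the translates of \<open>g\<close>\<close>
  show ?thesis
  proof (intro bexI[OF _ gm] conjI gfin ballI impI allI)
    fix h and \<epsilon> :: real assume [measurable]: "h \<in> borel_measurable borel" and h: "pint M p h < \<infinity>" and "0 < \<epsilon>"
    define \<eta> where "\<eta> = \<epsilon> / (2 powr p * 2)"
    have \<eta>: "\<eta> > 0" using \<open>0 < \<epsilon>\<close> by (simp add: \<eta>_def)
    obtain d where d: "d \<in> D" "pint M p (\<lambda>x. d x - h x) < ennreal \<eta>"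
      using D(6)[of h "ennreal \<eta>"] h \<eta> by auto
    obtain N where N: "(1/2::real) ^ N < \<eta> / 3"
      using real_arch_pow_inv[of "\<eta> / 3" "1/2"] \<eta> by auto
    \<comment> \<open>Recurrence of \<open>d\<close> in the sequence allows an index so late that
      the error \<open>3 * (1/2) ^ k\<close> is below \<open>\<eta>\<close>.\<close>
    obtain k where k: "N \<le> k" "\<phi> k = d" using \<phi>io[OF d(1)] by blast
    have "(1/2::real) ^ k \<le> (1/2) ^ N" using k by (intro power_decreasing) auto
    then have "3 * (1/2) ^ k < \<eta>" using N by linarith
    then have 1: "pint M p (\<lambda>t. g (- s k + t) - d t) < ennreal \<eta>"
      using close[of k] \<eta> k by (metis ennreal_lessI le_less_trans)
    have [measurable]: "d \<in> borel_measurable borel" using \<phi>m[of k] k by simp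
    have "pint M p (\<lambda>t. g (- s k + t) - h t)
        \<le> ennreal (2 powr p) * (pint M p (\<lambda>t. g (- s k + t) - d t) + pint M p (\<lambda>t. d t - h t))"
      using p by (intro pint_diff_le) auto
    also have "\<dots> < ennreal (2 powr p) * (ennreal \<eta> + ennreal \<eta>)"
      using d 1 by (intro ennreal_mult_strict_left_mono add_strict_mono) auto
    also have "\<dots> = ennreal \<epsilon>"
      using \<eta> by (simp add: \<eta>_def flip: ennreal_plus ennreal_mult)
    finally show "\<exists>s\<in>S. pint M p (\<lambda>t. g (- s + t) - h t) < ennreal \<epsilon>"
      using sS by blast
  qed
qed

subsection \<open>Weighted spaces\<close>

definition weighted_measure :: "'a measure \<Rightarrow> real \<Rightarrow> ('a \<Rightarrow> real) \<Rightarrow> 'a measure" where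
  "weighted_measure \<mu> p \<omega> = density \<mu> (\<lambda>t. ennreal (\<omega> t powr p))"

lemma weight_measurable:
  assumes sets: "sets \<mu> = sets borel" and w: "weight \<omega>"
  shows "\<omega> \<in> borel_measurable \<mu>"
proof -
  have "\<omega> \<in> borel_measurable borel" using w by (simp add: weight_def)
  then show ?thesis using sets measurable_cong_sets by blast
qed

context
  fixes \<mu> :: "'a :: topological_space measure" and p :: real and \<omega> :: "'a \<Rightarrow> real"
  assumes sets: "sets \<mu> = sets borel" and w: "weight \<omega>" and p: "1 \<le> p"
begin

lemma nn_integral_weighted_measure:
  assumes "u \<in> borel_measurable borel"
  shows "(\<integral>\<^sup>+t. u t \<partial>weighted_measure \<mu> p \<omega>) = (\<integral>\<^sup>+t. ennreal (\<omega> t powr p) * u t \<partial>\<mu>)"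
proof -
  have [measurable]: "u \<in> borel_measurable \<mu>" using assms sets measurable_cong_sets by blast
  note [measurable] = weight_measurable[OF sets w]
  show ?thesis unfolding weighted_measure_def by (rule nn_integral_density) measurable
qed

lemma pint_weighted_measure:
  assumes [measurable]: "h \<in> borel_measurable borel"
  shows "pint (weighted_measure \<mu> p \<omega>) p h = (\<integral>\<^sup>+t. ennreal (cmod (h t) powr p * \<omega> t powr p) \<partial>\<mu>)"
  unfolding pint_def
  by (subst nn_integral_weighted_measure) (auto simp: ennreal_mult mult.commute)

lemma mem_weighted_Lp_iff:
  "h \<in> weighted_Lp \<mu> p \<omega> \<longleftrightarrow> h \<in> borel_measurable borel \<and> pint (weighted_measure \<mu> p \<omega>) p h < \<infinity>"
proof -
  have "h \<in> borel_measurable \<mu> \<longleftrightarrow> h \<in> borel_measurable borel"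
    using sets measurable_cong_sets by blast
  then show ?thesis
    by (auto simp: weighted_Lp_def pint_weighted_measure)
qed

text \<open>The norm is the p-th root of the integral. Membership of \<open>h\<close> matters: the
  Bochner integral of a function that is not integrable is 0 by convention, and the norm would be 0
  as well.\<close>

lemma weighted_Lp_norm_less_iff:
  assumes h: "h \<in> weighted_Lp \<mu> p \<omega>" and "0 < \<epsilon>"
  shows "weighted_Lp_norm \<mu> p \<omega> h < \<epsilon> \<longleftrightarrow> pint (weighted_measure \<mu> p \<omega>) p h < ennreal (\<epsilon> powr p)"
proof -
  have hb: "h \<in> borel_measurable borel" and fin: "pint (weighted_measure \<mu> p \<omega>) p h < \<infinity>"
    using h by (auto simp: mem_weighted_Lp_iff)
  have [measurable]: "h \<in> borel_measurable \<mu>" using h by (simp add: weighted_Lp_def)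
  note [measurable] = weight_measurable[OF sets w]
  obtain r where r: "pint (weighted_measure \<mu> p \<omega>) p h = ennreal r" "0 \<le> r"
    using fin by (cases "pint (weighted_measure \<mu> p \<omega>) p h") auto
  have "(LINT t|\<mu>. cmod (h t) powr p * \<omega> t powr p) = r"
    by (subst integral_eq_nn_integral) (use r in \<open>auto simp: pint_weighted_measure[OF hb]\<close>)
  then have "weighted_Lp_norm \<mu> p \<omega> h = r powr (1 / p)"
    by (simp add: weighted_Lp_norm_def)
  moreover have "r powr (1 / p) < \<epsilon> \<longleftrightarrow> r < \<epsilon> powr p"
  proof -
    have "r powr (1 / p) < \<epsilon> \<longleftrightarrow> (r powr (1 / p)) powr p < \<epsilon> powr p"
    proof
      assume "r powr (1 / p) < \<epsilon>"
      then show "(r powr (1 / p)) powr p < \<epsilon> powr p"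
        using p by (intro powr_less_mono2) auto
    next
      assume "(r powr (1 / p)) powr p < \<epsilon> powr p"
      moreover have "\<epsilon> powr p \<le> (r powr (1 / p)) powr p" if "\<epsilon> \<le> r powr (1 / p)"
        using that p \<open>0 < \<epsilon>\<close> by (intro powr_mono2) auto
      ultimately show "r powr (1 / p) < \<epsilon>"
        by (meson not_le)
    qed
    then show ?thesis using p r by (simp add: powr_powr)
  qed
  ultimately show ?thesis
    using r by (simp add: ennreal_less_iff)
qed

lemma diff_mem_weighted_Lp:
  assumes "h \<in> weighted_Lp \<mu> p \<omega>" "k \<in> weighted_Lp \<mu> p \<omega>"
  shows "(\<lambda>t. h t - k t) \<in> weighted_Lp \<mu> p \<omega>"
proof -
  have [measurable]: "h \<in> borel_measurable borel" "k \<in> borel_measurable borel"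
    and fin: "pint (weighted_measure \<mu> p \<omega>) p h < \<infinity>" "pint (weighted_measure \<mu> p \<omega>) p k < \<infinity>"
    using assms by (auto simp: mem_weighted_Lp_iff)
  note [measurable_cong] = sets
  have "pint (weighted_measure \<mu> p \<omega>) p (\<lambda>t. h t + - k t) \<le> ennreal (2 powr p) *
      (pint (weighted_measure \<mu> p \<omega>) p h + pint (weighted_measure \<mu> p \<omega>) p (\<lambda>t. - k t))"
    using p by (intro pint_add_le) (auto simp: weighted_measure_def)
  also have "\<dots> < \<infinity>" using fin by (simp add: pint_uminus ennreal_mult_less_top)
  finally show ?thesis by (simp add: mem_weighted_Lp_iff)
qed

text \<open>Tolerances for the norm and for its p-th power correspond through
  \<open>\<epsilon> powr p\<close> and \<open>\<epsilon> powr (1 / p)\<close>; differences remain in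
  the space, so the comparison of the two applies.\<close>

lemma dense_in_weighted_Lp_iff:
  "dense_in_weighted_Lp \<mu> p \<omega> A \<longleftrightarrow> A \<subseteq> weighted_Lp \<mu> p \<omega> \<and>
    (\<forall>h\<in>weighted_Lp \<mu> p \<omega>. \<forall>\<epsilon>>0. \<exists>k\<in>A. pint (weighted_measure \<mu> p \<omega>) p (\<lambda>t. k t - h t) < ennreal \<epsilon>)"
proof (cases "A \<subseteq> weighted_Lp \<mu> p \<omega>")
  case True
  have iff: "weighted_Lp_norm \<mu> p \<omega> (\<lambda>t. k t - h t) < \<epsilon> \<longleftrightarrow>
      pint (weighted_measure \<mu> p \<omega>) p (\<lambda>t. k t - h t) < ennreal (\<epsilon> powr p)"
    if "k \<in> A" "h \<in> weighted_Lp \<mu> p \<omega>" "0 < \<epsilon>" for k h \<epsilon>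
    using that True diff_mem_weighted_Lp weighted_Lp_norm_less_iff by blast
  have "(\<forall>\<epsilon>>0. \<exists>k\<in>A. weighted_Lp_norm \<mu> p \<omega> (\<lambda>t. k t - h t) < \<epsilon>) \<longleftrightarrow>
      (\<forall>\<epsilon>>0. \<exists>k\<in>A. pint (weighted_measure \<mu> p \<omega>) p (\<lambda>t. k t - h t) < ennreal \<epsilon>)"
    if h: "h \<in> weighted_Lp \<mu> p \<omega>" for h
  proof safe
    fix \<epsilon> :: real assume "0 < \<epsilon>" and *: "\<forall>\<epsilon>>0. \<exists>k\<in>A. weighted_Lp_norm \<mu> p \<omega> (\<lambda>t. k t - h t) < \<epsilon>"
    have pos: "0 < \<epsilon> powr (1 / p)" using \<open>0 < \<epsilon>\<close> by simp
    then obtain k where "k \<in> A" "weighted_Lp_norm \<mu> p \<omega> (\<lambda>t. k t - h t) < \<epsilon> powr (1 / p)"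
      using * by blast
    then show "\<exists>k\<in>A. pint (weighted_measure \<mu> p \<omega>) p (\<lambda>t. k t - h t) < ennreal \<epsilon>"
      using iff[OF _ h pos] p \<open>0 < \<epsilon>\<close> by (auto simp: powr_powr)
  next
    fix \<epsilon> :: real assume "0 < \<epsilon>"
      and *: "\<forall>\<epsilon>>0. \<exists>k\<in>A. pint (weighted_measure \<mu> p \<omega>) p (\<lambda>t. k t - h t) < ennreal \<epsilon>"
    have "0 < \<epsilon> powr p" using \<open>0 < \<epsilon>\<close> by simp
    then obtain k where "k \<in> A" "pint (weighted_measure \<mu> p \<omega>) p (\<lambda>t. k t - h t) < ennreal (\<epsilon> powr p)"
      using * by blast
    then show "\<exists>k\<in>A. weighted_Lp_norm \<mu> p \<omega> (\<lambda>t. k t - h t) < \<epsilon>"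
      using iff[OF _ h \<open>0 < \<epsilon>\<close>] by blast
  qed
  then show ?thesis using True by (auto simp: dense_in_weighted_Lp_def)
qed (simp add: dense_in_weighted_Lp_def)

end

section \<open>Translation under the weighted Haar measure\<close>

text \<open>The image of \<open>\<mu>\<close> under left translation is \<open>\<mu>\<close>: the
  preimage of a set under \<open>s\<close> is its image under \<open>- s\<close>, and invariance is
  formulated with images.\<close>

lemma nn_integral_left_haar_translate:
  assumes haar: "left_haar_measure \<mu>" and [measurable]: "v \<in> borel_measurable borel"
  shows "(\<integral>\<^sup>+t. v (s + t) \<partial>\<mu>) = (\<integral>\<^sup>+t. v t \<partial>\<mu>)"
proof -
  have sets: "sets \<mu> = sets borel"
    and inv: "\<And>s A. A \<in> sets borel \<Longrightarrow> emeasure \<mu> ((\<lambda>t. s + t) ` A) = emeasure \<mu> A"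
    using haar by (auto simp: left_haar_measure_def)
  have sp: "space \<mu> = UNIV" using sets sets_eq_imp_space_eq by fastforce
  note [measurable] = measurable_translation[OF sets, of s]
  have "distr \<mu> borel (\<lambda>t. s + t) = \<mu>"
  proof (rule measure_eqI)
    fix A assume "A \<in> sets (distr \<mu> borel (\<lambda>t. s + t))"
    then have A: "A \<in> sets borel" by simp
    have "(\<lambda>t. s + t) -` A = (\<lambda>t. - s + t) ` A"
    proof safe
      fix t assume "s + t \<in> A"
      then show "t \<in> (\<lambda>t. - s + t) ` A"
        by (intro image_eqI[of _ _ "s + t"]) (simp_all add: add.assoc[symmetric])
    qed (simp add: add.assoc[symmetric])
    then show "emeasure (distr \<mu> borel (\<lambda>t. s + t)) A = emeasure \<mu> A"
      using A inv by (simp add: emeasure_distr sp)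
  qed (simp add: sets)
  then have "(\<integral>\<^sup>+t. v t \<partial>\<mu>) = (\<integral>\<^sup>+t. v t \<partial>distr \<mu> borel (\<lambda>t. s + t))" by simp
  also have "\<dots> = (\<integral>\<^sup>+t. v (s + t) \<partial>\<mu>)" by (rule nn_integral_distr) measurable
  finally show ?thesis by simp
qed

text \<open>Substituting \<open>s + t\<close> for \<open>t\<close> moves the translation from
  \<open>u\<close> to the weight, and admissibility bounds \<open>\<omega> (s + t)\<close> by
  \<open>m * \<omega> t\<close> almost everywhere. The factor is therefore
  \<open>m powr p\<close>.\<close>

lemma admissible_imp_translation_bounded:
  assumes haar: "left_haar_measure \<mu>" and w: "weight \<omega>" and p: "1 \<le> p" and adm: "admissible \<mu> S \<omega>"
    and "s \<in> S"
  shows "\<exists>c. \<forall>u\<in>borel_measurable borel.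
    (\<integral>\<^sup>+t. u (- s + t) \<partial>weighted_measure \<mu> p \<omega>) \<le> ennreal c * (\<integral>\<^sup>+t. u t \<partial>weighted_measure \<mu> p \<omega>)"
proof -
  have sets: "sets \<mu> = sets borel" using haar by (simp add: left_haar_measure_def)
  have [measurable]: "\<omega> \<in> borel_measurable borel" and wpos: "0 < \<omega> t" for t
    using w by (auto simp: weight_def)
  note [measurable_cong] = sets
  note [measurable] = measurable_translation[OF sets] measurable_translation[OF refl]
  have fin: "esssup \<mu> (\<lambda>t. ereal (\<omega> (s + t) / \<omega> t)) < \<infinity>" (is "?e < \<infinity>")
    using adm \<open>s \<in> S\<close> by (simp add: admissible_def)
  define m where "m = real_of_ereal ?e"
  have AE: "AE t in \<mu>. \<omega> (s + t) \<le> m * \<omega> t"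
    using esssup_AE[of "\<lambda>t. ereal (\<omega> (s + t) / \<omega> t)" \<mu>]
  proof eventually_elim
    case (elim t)
    then have "\<omega> (s + t) / \<omega> t \<le> m"
      using fin by (cases ?e) (auto simp: m_def)
    then show ?case using wpos[of t] by (simp add: field_simps)
  qed
  have "(\<integral>\<^sup>+t. u (- s + t) \<partial>weighted_measure \<mu> p \<omega>)
      \<le> ennreal (m powr p) * (\<integral>\<^sup>+t. u t \<partial>weighted_measure \<mu> p \<omega>)"
    if [measurable]: "u \<in> borel_measurable borel" for u
  proof -
    have "(\<integral>\<^sup>+t. u (- s + t) \<partial>weighted_measure \<mu> p \<omega>) = (\<integral>\<^sup>+t. ennreal (\<omega> t powr p) * u (- s + t) \<partial>\<mu>)"
      by (rule nn_integral_weighted_measure[OF sets w p]) measurable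
    also have "\<dots> = (\<integral>\<^sup>+t. ennreal (\<omega> (s + t) powr p) * u (- s + (s + t)) \<partial>\<mu>)"
      by (rule nn_integral_left_haar_translate[OF haar, symmetric]) measurable
    also have "\<dots> \<le> (\<integral>\<^sup>+t. ennreal (m powr p) * (ennreal (\<omega> t powr p) * u t) \<partial>\<mu>)"
    proof (rule nn_integral_mono_AE, use AE in eventually_elim)
      case (elim t)
      have "0 \<le> m" using elim wpos[of t] wpos[of "s + t"] by (smt (verit) mult_nonpos_nonneg)
      have "\<omega> (s + t) powr p \<le> (m * \<omega> t) powr p"
        using elim p less_imp_le[OF wpos] by (intro powr_mono2) auto
      also have "\<dots> = m powr p * \<omega> t powr p"
        using \<open>0 \<le> m\<close> less_imp_le[OF wpos] by (simp add: powr_mult)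
      finally have "ennreal (\<omega> (s + t) powr p) * u t \<le> ennreal (m powr p * \<omega> t powr p) * u t"
        by (intro mult_right_mono ennreal_leI) auto
      then show ?case by (simp add: ennreal_mult mult.assoc add.assoc[symmetric])
    qed
    also have "\<dots> = ennreal (m powr p) * (\<integral>\<^sup>+t. ennreal (\<omega> t powr p) * u t \<partial>\<mu>)"
      by (rule nn_integral_cmult) measurable
    also have "\<dots> = ennreal (m powr p) * (\<integral>\<^sup>+t. u t \<partial>weighted_measure \<mu> p \<omega>)"
      by (subst nn_integral_weighted_measure[OF sets w p]) auto
    finally show ?thesis .
  qed
  then show ?thesis by blast
qed

text \<open>Each point has a compact neighbourhood, of finite weighted measure by local
  integrability, and a basic open set fits inside it. The members of a countable base with finite
  measure therefore cover the group.\<close>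

lemma sigma_finite_weighted_measure:
  fixes \<mu> :: "'a :: {second_countable_topology, t2_space} measure"
  assumes lc: "locally compact (UNIV :: 'a set)" and sets: "sets \<mu> = sets borel"
    and w: "weight \<omega>" and p: "1 \<le> p" and int: "locally_p_integrable \<mu> p \<omega>"
  shows "sigma_finite_measure (weighted_measure \<mu> p \<omega>)"
proof
  let ?\<nu> = "weighted_measure \<mu> p \<omega>"
  have sets\<nu>: "sets ?\<nu> = sets borel" by (simp add: weighted_measure_def sets)
  have sp: "space ?\<nu> = UNIV" using sets\<nu> sets_eq_imp_space_eq by fastforce
  obtain B :: "'a set set" where B: "countable B" "topological_basis B"
    using ex_countable_basis by blast
  have fin: "emeasure ?\<nu> K < \<infinity>" if "compact K" for K
  proof -
    have "K \<in> sets borel" by (rule borel_closed[OF compact_imp_closed[OF that]])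
    then have "emeasure ?\<nu> K = (\<integral>\<^sup>+t\<in>K. ennreal (\<omega> t powr p) \<partial>\<mu>)"
      unfolding weighted_measure_def using weight_measurable[OF sets w]
      by (intro emeasure_density) (auto simp: sets)
    then show ?thesis using int that by (simp add: locally_p_integrable_def)
  qed
  define B' where "B' = {b\<in>B. emeasure ?\<nu> b \<noteq> \<infinity>}"
  have cover: "x \<in> \<Union>B'" for x
  proof -
    have "\<exists>u v. open u \<and> compact v \<and> x \<in> u \<and> u \<subseteq> v"
      using lc[unfolded locally_def, rule_format, of UNIV x] by (simp add: conj_assoc)
    then obtain u v where uv: "open u" "compact v" "x \<in> u" "u \<subseteq> v"
      by blast
    obtain b where b: "b \<in> B" "x \<in> b" "b \<subseteq> u"
      using topological_basisE[OF B(2) uv(1,3)] by blast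
    have "emeasure ?\<nu> b \<le> emeasure ?\<nu> v"
      using b uv compact_imp_closed[OF uv(2)] by (intro emeasure_mono) (auto simp: sets\<nu>)
    then show ?thesis using fin[OF uv(2)] b by (auto simp: B'_def top_unique)
  qed
  show "\<exists>A. countable A \<and> A \<subseteq> sets ?\<nu> \<and> \<Union>A = space ?\<nu> \<and> (\<forall>a\<in>A. emeasure ?\<nu> a \<noteq> \<infinity>)"
  proof (intro exI[of _ B'] conjI ballI)
    show "countable B'" using B(1) by (simp add: B'_def)
    show "B' \<subseteq> sets ?\<nu>" using topological_basis_open[OF B(2)] by (auto simp: B'_def sets\<nu>)
    show "\<Union>B' = space ?\<nu>" unfolding sp using cover by blast
    show "emeasure ?\<nu> b \<noteq> \<infinity>" if "b \<in> B'" for b using that by (simp add: B'_def)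
  qed
qed

lemma emeasure_weighted_measure_nonzero:
  assumes sets: "sets \<mu> = sets borel" and w: "weight \<omega>" and p: "1 \<le> p" and nz: "emeasure \<mu> UNIV \<noteq> 0"
  shows "emeasure (weighted_measure \<mu> p \<omega>) UNIV \<noteq> 0"
proof
  have sp: "space \<mu> = UNIV" using sets sets_eq_imp_space_eq by fastforce
  note [measurable] = weight_measurable[OF sets w]
  assume "emeasure (weighted_measure \<mu> p \<omega>) UNIV = 0"
  then have "(\<integral>\<^sup>+t. ennreal (\<omega> t powr p) \<partial>\<mu>) = 0"
    unfolding weighted_measure_def by (subst (asm) emeasure_density) (auto simp: sets)
  then have "AE t in \<mu>. ennreal (\<omega> t powr p) = 0"
    by (subst (asm) nn_integral_0_iff_AE) auto
  then have "AE t in \<mu>. False"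
  proof eventually_elim
    case (elim t)
    moreover have "0 < \<omega> t" using w unfolding weight_def by blast
    ultimately show ?case by simp
  qed
  then have "emeasure \<mu> UNIV = 0"
    by (subst (asm) AE_iff_measurable[of UNIV]) (auto simp: sets sp)
  with nz show False by simp
qed

section \<open>Equivalence of the two kinds of density\<close>

theorem corollary1p3:
  fixes \<mu> :: "'a :: {topological_group_add, t2_space, second_countable_topology} measure"
    and S :: "'a set"
    and p :: real
    and \<Gamma> :: "complex set"
    and \<omega> :: "'a \<Rightarrow> real"
  assumes "locally compact (UNIV :: 'a set)"
    and "\<not> compact (UNIV :: 'a set)"
    and "left_haar_measure \<mu>"
    and "1 \<le> p"
    and "\<Gamma> - {0} \<noteq> {}"
    and "weight \<omega>"
    and "locally_p_integrable \<mu> p \<omega>"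
    and "admissible \<mu> S \<omega>"
    and "bounded (\<Gamma> - {0})"
    and "\<exists>\<delta>>0. \<forall>z\<in>\<Gamma> - {0}. \<delta> \<le> cmod z"
  shows "(\<exists>f. S_dense_vector \<mu> p \<omega> S f) \<longleftrightarrow> (\<exists>f. Gamma_S_dense_vector \<mu> p \<omega> \<Gamma> S f)"
proof -
  let ?\<nu> = "weighted_measure \<mu> p \<omega>"
  have sets: "sets \<mu> = sets borel" and nz: "emeasure \<mu> UNIV \<noteq> 0"
    using assms(3) by (auto simp: left_haar_measure_def)
  have sets\<nu>: "sets ?\<nu> = sets borel" by (simp add: weighted_measure_def sets)
  note [measurable_cong] = sets\<nu>
  note Lp_iff = mem_weighted_Lp_iff[OF sets assms(6,4)]
    and dense_iff = dense_in_weighted_Lp_iff[OF sets assms(6,4)]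
  have "\<forall>s\<in>S. \<exists>c. \<forall>u\<in>borel_measurable borel. (\<integral>\<^sup>+t. u (- s + t) \<partial>?\<nu>) \<le> ennreal c * (\<integral>\<^sup>+t. u t \<partial>?\<nu>)"
    using admissible_imp_translation_bounded[OF assms(3,6,4,8)] by blast
  then obtain c where c: "\<And>s u. s \<in> S \<Longrightarrow> u \<in> borel_measurable borel \<Longrightarrow>
      (\<integral>\<^sup>+t. u (- s + t) \<partial>?\<nu>) \<le> ennreal (c s) * (\<integral>\<^sup>+t. u t \<partial>?\<nu>)"
    by metis
  note [measurable] = measurable_translation[OF refl]
  have trans_Lp: "left_translation s f \<in> weighted_Lp \<mu> p \<omega>"
    if "f \<in> weighted_Lp \<mu> p \<omega>" "s \<in> S" for f s
  proof -
    have [measurable]: "f \<in> borel_measurable borel" and fin: "pint ?\<nu> p f < \<infinity>"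
      using that by (auto simp: Lp_iff)
    have "pint ?\<nu> p (\<lambda>t. f (- s + t)) \<le> ennreal (c s) * pint ?\<nu> p f"
      unfolding pint_def by (rule c[OF \<open>s \<in> S\<close>, where u="\<lambda>t. ennreal (cmod (f t) powr p)"]) measurable
    also have "\<dots> < \<infinity>" using fin by (simp add: ennreal_mult_less_top)
    finally show ?thesis by (simp add: Lp_iff left_translation_def)
  qed
  have scale_Lp: "(\<lambda>t. z * f t) \<in> weighted_Lp \<mu> p \<omega>" if "f \<in> weighted_Lp \<mu> p \<omega>" for z f
    using that by (auto simp: Lp_iff pint_mult ennreal_mult_less_top)
  \<comment> \<open>Translates and multiples stay in the space by admissibility, so the containment
    part of density is automatic here and in \<open>\<Gamma>_iff\<close>.\<close>
  have S_iff: "S_dense_vector \<mu> p \<omega> S f \<longleftrightarrow> f \<in> weighted_Lp \<mu> p \<omega> \<and> (\<forall>h\<in>weighted_Lp \<mu> p \<omega>. \<forall>\<epsilon>>0.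
      \<exists>s\<in>S. pint ?\<nu> p (\<lambda>t. left_translation s f t - h t) < ennreal \<epsilon>)" for f
  proof -
    have "{left_translation s f | s. s \<in> S} = (\<lambda>s. left_translation s f) ` S" by auto
    moreover have "(\<lambda>s. left_translation s f) ` S \<subseteq> weighted_Lp \<mu> p \<omega>" if "f \<in> weighted_Lp \<mu> p \<omega>"
      using trans_Lp[OF that] by auto
    ultimately show ?thesis
      unfolding S_dense_vector_def dense_iff by (simp cong: conj_cong)
  qed
  have \<Gamma>_iff: "Gamma_S_dense_vector \<mu> p \<omega> \<Gamma> S f \<longleftrightarrow> f \<in> weighted_Lp \<mu> p \<omega> \<and> (\<forall>h\<in>weighted_Lp \<mu> p \<omega>. \<forall>\<epsilon>>0.
      \<exists>z\<in>\<Gamma>. \<exists>s\<in>S. pint ?\<nu> p (\<lambda>t. z * left_translation s f t - h t) < ennreal \<epsilon>)" for f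
  proof -
    have "{(\<lambda>t. z * left_translation s f t) | z s. z \<in> \<Gamma> \<and> s \<in> S}
        = (\<lambda>(z, s) t. z * left_translation s f t) ` (\<Gamma> \<times> S)" by auto
    moreover have "(\<lambda>(z, s) t. z * left_translation s f t) ` (\<Gamma> \<times> S) \<subseteq> weighted_Lp \<mu> p \<omega>"
      if "f \<in> weighted_Lp \<mu> p \<omega>"
      using scale_Lp[OF trans_Lp[OF that]] by auto
    ultimately show ?thesis
      unfolding Gamma_S_dense_vector_def dense_iff by (simp cong: conj_cong)
  qed
  show ?thesis
  proof
    assume "\<exists>f. S_dense_vector \<mu> p \<omega> S f"
    then obtain f where f: "f \<in> weighted_Lp \<mu> p \<omega>"
      and dense: "\<And>h \<epsilon>. h \<in> weighted_Lp \<mu> p \<omega> \<Longrightarrow> 0 < \<epsilon> \<Longrightarrow>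
        \<exists>s\<in>S. pint ?\<nu> p (\<lambda>t. left_translation s f t - h t) < ennreal \<epsilon>"
      unfolding S_iff by blast
    \<comment> \<open>One nonzero scalar suffices, and \<open>f\<close> itself serves: approximating
      \<open>h\<close> by \<open>z\<close> times a translate amounts to approximating
      \<open>inverse z * h\<close> by the translate.\<close>
    obtain z where z: "z \<in> \<Gamma>" "z \<noteq> 0" using assms(5) by blast
    have "\<exists>s\<in>S. pint ?\<nu> p (\<lambda>t. z * left_translation s f t - h t) < ennreal \<epsilon>"
      if h: "h \<in> weighted_Lp \<mu> p \<omega>" and "0 < \<epsilon>" for h \<epsilon>
    proof -
      have zp: "0 < cmod z powr p" using z by simp
      obtain s where s: "s \<in> S"
        "pint ?\<nu> p (\<lambda>t. left_translation s f t - inverse z * h t) < ennreal (\<epsilon> / cmod z powr p)"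
        using dense[OF scale_Lp[OF h, of "inverse z"], of "\<epsilon> / cmod z powr p"] zp \<open>0 < \<epsilon>\<close> by auto
      have [measurable]: "left_translation s f \<in> borel_measurable borel" "h \<in> borel_measurable borel"
        using trans_Lp[OF f s(1)] h by (auto simp: Lp_iff)
      have "pint ?\<nu> p (\<lambda>t. z * left_translation s f t - h t)
          = pint ?\<nu> p (\<lambda>t. z * (left_translation s f t - inverse z * h t))"
        using z by (simp add: right_diff_distrib mult.assoc[symmetric])
      also have "\<dots> = ennreal (cmod z powr p) * pint ?\<nu> p (\<lambda>t. left_translation s f t - inverse z * h t)"
        by (rule pint_mult) measurable
      also have "\<dots> < ennreal (cmod z powr p) * ennreal (\<epsilon> / cmod z powr p)"
        using s zp by (intro ennreal_mult_strict_left_mono) auto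
      also have "\<dots> = ennreal \<epsilon>"
        using zp \<open>0 < \<epsilon>\<close> by (simp flip: ennreal_mult)
      finally show ?thesis using s by blast
    qed
    then have "Gamma_S_dense_vector \<mu> p \<omega> \<Gamma> S f"
      unfolding \<Gamma>_iff using f z(1) by blast
    then show "\<exists>f. Gamma_S_dense_vector \<mu> p \<omega> \<Gamma> S f" by blast
  next
    assume "\<exists>f. Gamma_S_dense_vector \<mu> p \<omega> \<Gamma> S f"
    then obtain f where f: "f \<in> weighted_Lp \<mu> p \<omega>"
      and dense: "\<And>h \<epsilon>. h \<in> weighted_Lp \<mu> p \<omega> \<Longrightarrow> 0 < \<epsilon> \<Longrightarrow>
        \<exists>z\<in>\<Gamma>. \<exists>s\<in>S. pint ?\<nu> p (\<lambda>t. z * left_translation s f t - h t) < ennreal \<epsilon>"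
      unfolding \<Gamma>_iff by blast
    have dense': "\<exists>z\<in>\<Gamma>. \<exists>s\<in>S. pint ?\<nu> p (\<lambda>t. z * f (- s + t) - h t) < \<epsilon>"
      if "h \<in> borel_measurable borel" "pint ?\<nu> p h < \<infinity>" "0 < \<epsilon>" for h \<epsilon>
    proof -
      obtain e where e: "0 < e" "ennreal e \<le> \<epsilon>"
        using ennreal_pos_imp_real_le[OF \<open>0 < \<epsilon>\<close>] by blast
      have "h \<in> weighted_Lp \<mu> p \<omega>" using that by (simp add: Lp_iff)
      then obtain z s where "z \<in> \<Gamma>" "s \<in> S" "pint ?\<nu> p (\<lambda>t. z * f (- s + t) - h t) < ennreal e"
        using dense[of h e] e(1) unfolding left_translation_def by blast
      then show ?thesis
        using less_le_trans[OF _ e(2)] by blast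
    qed
    obtain \<delta> where \<delta>: "0 < \<delta>" "\<And>z. z \<in> \<Gamma> - {0} \<Longrightarrow> \<delta> \<le> cmod z" using assms(10) by blast
    obtain C where C: "0 < C" "\<And>z. z \<in> \<Gamma> - {0} \<Longrightarrow> cmod z \<le> C"
      using assms(9) unfolding bounded_pos by blast
    have sf: "sigma_finite_measure ?\<nu>"
      by (rule sigma_finite_weighted_measure[OF assms(1) sets assms(6,4,7)])
    have nz\<nu>: "emeasure ?\<nu> UNIV \<noteq> 0"
      by (rule emeasure_weighted_measure_nonzero[OF sets assms(6,4) nz])
    have fb: "f \<in> borel_measurable borel" "pint ?\<nu> p f < \<infinity>" using f by (auto simp: Lp_iff)
    have "\<exists>g\<in>borel_measurable borel. pint ?\<nu> p g < \<infinity> \<and>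
        (\<forall>h\<in>borel_measurable borel. pint ?\<nu> p h < \<infinity> \<longrightarrow>
          (\<forall>\<epsilon>>0. \<exists>s\<in>S. pint ?\<nu> p (\<lambda>t. g (- s + t) - h t) < ennreal \<epsilon>))"
      by (rule exists_dense_translates[where C=C and c=c, OF sets\<nu> sf nz\<nu> assms(4) fb dense'
            conjI[OF \<delta>(2) C(2)] \<delta>(1) C(1) c])
    then obtain g where g: "g \<in> borel_measurable borel" "pint ?\<nu> p g < \<infinity>"
      "\<And>h \<epsilon>. h \<in> borel_measurable borel \<Longrightarrow> pint ?\<nu> p h < \<infinity> \<Longrightarrow> 0 < \<epsilon> \<Longrightarrow>
        \<exists>s\<in>S. pint ?\<nu> p (\<lambda>t. g (- s + t) - h t) < ennreal \<epsilon>"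
      by blast
    have gL: "g \<in> weighted_Lp \<mu> p \<omega>" using g(1,2) by (simp add: Lp_iff)
    have "S_dense_vector \<mu> p \<omega> S g"
      unfolding S_iff left_translation_def
    proof (intro conjI gL ballI allI impI)
      fix h and \<epsilon> :: real assume "h \<in> weighted_Lp \<mu> p \<omega>" "0 < \<epsilon>"
      then show "\<exists>s\<in>S. pint ?\<nu> p (\<lambda>t. g (- s + t) - h t) < ennreal \<epsilon>"
        by (intro g(3)) (auto simp: Lp_iff)
    qed
    then show "\<exists>f. S_dense_vector \<mu> p \<omega> S f" by blast
  qed
qed

end
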